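(* Let $(z^j)_{j\ge0}$ be generated by relaxed ADMM with parameter $\gamma>0$ and relaxation parameters $(\lambda_j)_{j\ge0}\subset(0,1]$, and let $z^\ast$ be a fixed point of $T_{\mathrm{PRS}}$. The following are true. 1. If $\mu_g\beta_g\alpha_B>0$, then $(z^j)_{j\ge0}$ converges linearly and, for all $k\ge0$, $$\|z^{k+1}-z^\ast\|^2\le\Big(1-\frac{4\gamma\lambda_k\beta_g\alpha_B}{(1+\gamma\|B\|^2/\mu_g)^2}\Big)^{1/2}\|z^k-z^\ast\|^2.$$ 2. If $\mu_f\beta_f\alpha_A>0$, then $(z^j)_{j\ge0}$ converges linearly and, for all $k\ge0$, $$\|z^{k+1}-z^\ast\|^2\le\Big(1-\frac{\lambda_k}2\min\Big\{\frac{4\gamma\beta_f\alpha_A}{(1+\gamma\|A\|^2/\mu_f)^2},\,1-\lambda_k\Big\}\Big)^{1/2}\|z^k-z^\ast\|^2.$$ 3. If $\mu_f\beta_g\alpha_B>0$, then $(z^j)_{j\ge0}$ converges linearly and, for all $k\ge0$, $$\|z^{k+1}-z^\ast\|^2\le\Big(1-\frac{4\lambda_k}3\min\Big\{\gamma\beta_g\alpha_B,\ \frac{\mu_f}{\|A\|^2\gamma},\ 1-\lambda_k\Big\}\Big)^{1/2}\|z^k-z^\ast\|^2.$$ 4. If $\mu_g\beta_f\alpha_A>0$, then $(z^j)_{j\ge0}$ converges linearly and, for all $k\ge0$, $$\|z^{k+1}-z^\ast\|^2\le\Big(1-\frac{4\lambda_k}3\min\Big\{\gamma\beta_f\alpha_A,\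 \frac{\mu_g}{\|B\|^2\gamma},\ 1-\lambda_k\Big\}\Big)^{1/2}\|z^k-z^\ast\|^2.$$
   Context: $\mathcal H_1,\mathcal H_2,\mathcal G$ are real Hilbert spaces; $A:\mathcal H_1\to\mathcal G$, $B:\mathcal H_2\to\mathcal G$ are nonzero bounded linear operators; $b\in\mathcal G$; $f:\mathcal H_1\to(-\infty,\infty]$, $g:\mathcal H_2\to(-\infty,\infty]$ are closed, proper, convex. The primal problem is to minimize $f(x)+g(y)$ subject to $Ax+By=b$. With $f^\ast,g^\ast$ the convex conjugates, set $d_f(w)=f^\ast(A^\ast w)$, $d_g(w)=g^\ast(B^\ast w)-\langle w,b\rangle$ on $\mathcal G$. Standing assumptions: there is $w$ with $0\in\partial d_f(w)+\partial d_g(w)$, and the chain rules $\partial d_f(w)=A\,\partial f^\ast(A^\ast w)$, $\partial d_g(w)=B\,\partial g^\ast(B^\ast w)-b$ hold for all $w$. Relaxed ADMM: let $w^{-1}\in\mathcal G$, $x^{-1}=0$, $y^{-1}=0$, $\lambda_{-1}=1/2$. For $k=-1,0,1,\dots$: $y^{k+1}\in\arg\min_y g(y)-\langle w^k,Ax^k+By-b\rangle+\frac\gamma2\|Ax^k+By-b+(2\lambda_k-1)(Ax^k+By^k-b)\|^2$; $w^{k+1}=w^k-\gamma(Ax^k+By^{k+1}-b)-\gamma(2\lambda_k-1)(Ax^k+By^k-b)$; $x^{k+1}\in\arg\min_x f(x)-\langle w^{k+1},Ax+By^{k+1}-b\rangle+\frac\gamma2\|Ax+By^{k+1}-b\|^2$.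 The associated sequence $(z^k)$ is $z^0=w^{-1}$, $z^{k+1}=z^k-2\gamma\lambda_k(Ax^k+By^k-b)$ for $k\ge0$. Equivalently, $z^{k+1}=(1-\lambda_k)z^k+\lambda_kT_{\mathrm{PRS}}z^k$ with $T_{\mathrm{PRS}}=\mathbf{refl}_{\gamma d_f}\circ\mathbf{refl}_{\gamma d_g}$, where $\mathbf{prox}_{\gamma h}(w)=\arg\min_v h(v)+\frac1{2\gamma}\|v-w\|^2$ and $\mathbf{refl}_{\gamma h}=2\,\mathbf{prox}_{\gamma h}-I$. Regularity constants (any may be $0$, meaning no assumption): $f$, $g$ are $\mu_f$-, $\mu_g$-strongly convex; if $\beta_f>0$ (resp. $\beta_g>0$) then $f$ (resp. $g$) is Fréchet differentiable with $(1/\beta_f)$- (resp. $(1/\beta_g)$-) Lipschitz gradient; $\langle AA^\ast w,w\rangle\ge\alpha_A\|w\|^2$ and $\langle BB^\ast w,w\rangle\ge\alpha_B\|w\|^2$ for all $w\in\mathcal G$.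
   Formalization: Linear convergence is claimed in parts 1, 2 only if λ_k is eventually bounded away from 0, and in parts 3, 4 only if λ_k(1−λ_k) is; without this it fails (e.g. f the indicator of {0}, g=0, λ_k=1 in part 3). The displayed inequalities hold unconditionally. *)

theory Defs
  imports "HOL-Analysis.Analysis"
begin

text \<open>
  Real Hilbert spaces are types of sort \<open>{real_inner, complete_space}\<close>; functions with values in
  $(-\infty,\infty]$ are \<open>ereal\<close>-valued functions that never take the value \<open>-\<infinity>\<close>.
\<close>

definition epigraph_ereal :: "('a \<Rightarrow> ereal) \<Rightarrow> ('a \<times> real) set" where
  "epigraph_ereal h = {(x, r). h x \<le> ereal r}"

definition proper_fun :: "('a \<Rightarrow> ereal) \<Rightarrow> bool" where
  "proper_fun h \<longleftrightarrow> (\<forall>x. h x \<noteq> -\<infinity>) \<and> (\<exists>x. h x \<noteq> \<infinity>)"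

definition closed_proper_convex :: "('a::real_inner \<Rightarrow> ereal) \<Rightarrow> bool" where
  "closed_proper_convex h \<longleftrightarrow>
     closed (epigraph_ereal h) \<and> proper_fun h \<and> convex (epigraph_ereal h)"

definition strongly_convex :: "real \<Rightarrow> ('a::real_inner \<Rightarrow> ereal) \<Rightarrow> bool" where
  "strongly_convex \<mu> h \<longleftrightarrow>
     (\<forall>x y t. 0 < t \<and> t < 1 \<longrightarrow>
        h ((1 - t) *\<^sub>R x + t *\<^sub>R y) + ereal (\<mu> / 2 * t * (1 - t) * (norm (x - y))\<^sup>2)
          \<le> ereal (1 - t) * h x + ereal t * h y)"

text \<open>Frechet differentiability on the whole space, so in particular \<open>h\<close> is finite everywhere.\<close>

definition lipschitz_gradient :: "real \<Rightarrow> ('a::real_inner \<Rightarrow> ereal) \<Rightarrow> bool" where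
  "lipschitz_gradient L h \<longleftrightarrow>
     (\<exists>H grad. (\<forall>x. h x = ereal (H x)) \<and>
        (\<forall>x. (H has_derivative (\<lambda>v. grad x \<bullet> v)) (at x)) \<and>
        L-lipschitz_on UNIV grad)"

definition fenchel_conjugate :: "('a::real_inner \<Rightarrow> ereal) \<Rightarrow> 'a \<Rightarrow> ereal" where
  "fenchel_conjugate h u = (SUP x. ereal (u \<bullet> x) - h x)"

definition subdifferential :: "('a::real_inner \<Rightarrow> ereal) \<Rightarrow> 'a \<Rightarrow> 'a set" where
  "subdifferential h w =
     {u. \<bar>h w\<bar> \<noteq> \<infinity> \<and> (\<forall>v. h v \<ge> h w + ereal (u \<bullet> (v - w)))}"

definition dual_f ::
  "('a::{real_inner,complete_space} \<Rightarrow> ereal) \<Rightarrow> ('a \<Rightarrow>\<^sub>L 'g::{real_inner,complete_space}) \<Rightarrow> 'g \<Rightarrow> ereal"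
  where "dual_f f A w = fenchel_conjugate f (adjoint (blinfun_apply A) w)"

definition dual_g ::
  "('b::{real_inner,complete_space} \<Rightarrow> ereal) \<Rightarrow> ('b \<Rightarrow>\<^sub>L 'g::{real_inner,complete_space}) \<Rightarrow> 'g \<Rightarrow> 'g \<Rightarrow> ereal"
  where "dual_g g B b w = fenchel_conjugate g (adjoint (blinfun_apply B) w) - ereal (w \<bullet> b)"

text \<open>For closed, proper, convex \<open>h\<close> on a Hilbert space and \<open>\<gamma> > 0\<close> the minimizer exists and is unique;
  only then is the value of \<open>ARG_MIN\<close> meaningful.\<close>

definition prox :: "real \<Rightarrow> ('g::real_inner \<Rightarrow> ereal) \<Rightarrow> 'g \<Rightarrow> 'g" where
  "prox \<gamma> h w = (ARG_MIN (\<lambda>v. h v + ereal (1 / (2 * \<gamma>) * (norm (v - w))\<^sup>2)) v. True)"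

definition refl_prox :: "real \<Rightarrow> ('g::real_inner \<Rightarrow> ereal) \<Rightarrow> 'g \<Rightarrow> 'g" where
  "refl_prox \<gamma> h w = 2 *\<^sub>R prox \<gamma> h w - w"

definition T_PRS :: "real \<Rightarrow> ('g::real_inner \<Rightarrow> ereal) \<Rightarrow> ('g \<Rightarrow> ereal) \<Rightarrow> 'g \<Rightarrow> 'g" where
  "T_PRS \<gamma> df dg = refl_prox \<gamma> df \<circ> refl_prox \<gamma> dg"

text \<open>The iterates start at index \<open>-1\<close>, hence the integer indices (indices below \<open>-1\<close> are
  unconstrained). The initial dual point \<open>w (-1)\<close> is arbitrary.\<close>

definition relaxed_admm ::
  "('a::real_inner \<Rightarrow> ereal) \<Rightarrow> ('b::real_inner \<Rightarrow> ereal) \<Rightarrow> ('a \<Rightarrow>\<^sub>L 'g::real_inner) \<Rightarrow> ('b \<Rightarrow>\<^sub>L 'g) \<Rightarrow> 'g \<Rightarrow>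
   real \<Rightarrow> (int \<Rightarrow> real) \<Rightarrow> (int \<Rightarrow> 'a) \<Rightarrow> (int \<Rightarrow> 'b) \<Rightarrow> (int \<Rightarrow> 'g) \<Rightarrow> bool"
  where
  "relaxed_admm f g A B b \<gamma> lam x y w \<longleftrightarrow>
     x (-1) = 0 \<and> y (-1) = 0 \<and> lam (-1) = 1/2 \<and>
     (\<forall>k\<ge>-1.
        is_arg_min
          (\<lambda>v. g v - ereal (w k \<bullet> (A (x k) + B v - b))
             + ereal (\<gamma> / 2 * (norm (A (x k) + B v - b
                 + (2 * lam k - 1) *\<^sub>R (A (x k) + B (y k) - b)))\<^sup>2))
          (\<lambda>v. True) (y (k + 1)) \<and>
        w (k + 1) = w k - \<gamma> *\<^sub>R (A (x k) + B (y (k + 1)) - b)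
             - (\<gamma> * (2 * lam k - 1)) *\<^sub>R (A (x k) + B (y k) - b) \<and>
        is_arg_min
          (\<lambda>u. f u - ereal (w (k + 1) \<bullet> (A u + B (y (k + 1)) - b))
             + ereal (\<gamma> / 2 * (norm (A u + B (y (k + 1)) - b))\<^sup>2))
          (\<lambda>u. True) (x (k + 1)))"

definition admm_z_sequence ::
  "('a::real_inner \<Rightarrow>\<^sub>L 'g::real_inner) \<Rightarrow> ('b::real_inner \<Rightarrow>\<^sub>L 'g) \<Rightarrow> 'g \<Rightarrow>
   real \<Rightarrow> (int \<Rightarrow> real) \<Rightarrow> (int \<Rightarrow> 'a) \<Rightarrow> (int \<Rightarrow> 'b) \<Rightarrow> (int \<Rightarrow> 'g) \<Rightarrow> (nat \<Rightarrow> 'g) \<Rightarrow> bool"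
  where
  "admm_z_sequence A B b \<gamma> lam x y w z \<longleftrightarrow>
     z 0 = w (-1) \<and>
     (\<forall>k. z (Suc k) =
        z k - (2 * \<gamma> * lam (int k)) *\<^sub>R (A (x (int k)) + B (y (int k)) - b))"

text \<open>Q-linear convergence: the ratio of successive distances to the limit is eventually bounded
  by some \<open>q < 1\<close>.\<close>

definition converges_linearly_to :: "(nat \<Rightarrow> 'g::metric_space) \<Rightarrow> 'g \<Rightarrow> bool" where
  "converges_linearly_to z l \<longleftrightarrow>
     (\<exists>q. 0 \<le> q \<and> q < 1 \<and> (\<forall>\<^sub>F k in sequentially. dist (z (Suc k)) l \<le> q * dist (z k) l))"

definition eventually_bounded_away_from_0 :: "(nat \<Rightarrow> real) \<Rightarrow> bool" where
  "eventually_bounded_away_from_0 s \<longleftrightarrow> (\<exists>\<epsilon>>0. \<forall>\<^sub>F k in sequentially. \<epsilon> \<le> s k)"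

end

theory Submission
  imports Defs
begin

text \<open>
  Write $W$, $V$, $P$, $Q$ for the errors of $w^k$, of $w^k - \gamma(Ax^k + By^k - b)$, of $By^k$ and of
  $Ax^k$ with respect to a primal-dual solution read off from the fixed point $z^*$, and $Z$ for the error of
  $z^k$. Then $Z = W + \gamma P$, $V = W - \gamma P - \gamma Q$, and
  $$\|Z - 2\gamma\lambda(P + Q)\|^2 = \|Z\|^2 - 4\lambda\bigl(\gamma\langle P, W\rangle + \gamma\langle Q, V\rangle
     + (1-\lambda)\|\gamma(P+Q)\|^2\bigr).$$
  Optimality of the iterates, transported through the adjoints, bounds $\langle P, W\rangle$ and $\langle Q, V\rangle$
  below: strong convexity by multiples of $\|P\|^2$ and $\|Q\|^2$, a Lipschitz gradient and the
  surjectivity constants by multiples of $\|W\|^2$ and $\|V\|^2$. Each rate expresses $Z$ through the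
  quantities controlled this way. These arguments bound $\|z^{k+1}-z^*\|^2$ by $(1 - C)\|z^k-z^*\|^2$, which
  is stronger than the claimed factor $(1-C)^{1/2}$.
\<close>

section \<open>Subgradients and first-order conditions for extended-real convex functions\<close>

lemma ereal_finite_cases:
  assumes "h x \<noteq> -\<infinity>" "h x \<noteq> (\<infinity>::ereal)"
  obtains r where "h x = ereal r"
  using assms by (cases "h x") auto

lemma subgradient_ineq:
  assumes "p \<in> subdifferential h x" "h x = ereal r" "h y = ereal s"
  shows "r + p \<bullet> (y - x) \<le> s"
  using assms unfolding subdifferential_def by (auto dest: spec[of _ y])

lemma subgradient_finite:
  assumes "p \<in> subdifferential h x"
  obtains r where "h x = ereal r"
  using assms unfolding subdifferential_def by (cases "h x") auto

text \<open>Let \<open>t\<close> tend to 0 from the right. The first-order arguments along segments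
  reach this form after division by the step length.\<close>

lemma real_nonpos_if_le_multiples:
  fixes c K :: real
  assumes "\<And>t. 0 < t \<Longrightarrow> t < 1 \<Longrightarrow> c \<le> t * K"
  shows "c \<le> 0"
proof (rule tendsto_lowerbound)
  show "((\<lambda>t. t * K) \<longlongrightarrow> 0) (at_right 0)"
    by (auto intro!: tendsto_eq_intros)
  show "\<forall>\<^sub>F t in at_right 0. c \<le> t * K"
    using assms by (auto simp: eventually_at_right_field intro!: exI[of _ 1])
qed auto

lemma closed_proper_convex_convex_comb:
  assumes "closed_proper_convex h" "h x \<le> ereal r" "h y \<le> ereal s" "0 \<le> t" "t \<le> 1"
  shows "h ((1 - t) *\<^sub>R x + t *\<^sub>R y) \<le> ereal ((1 - t) * r + t * s)"
proof -
  have "convex (epigraph_ereal h)" and "(x, r) \<in> epigraph_ereal h" "(y, s) \<in> epigraph_ereal h"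
    using assms by (auto simp: closed_proper_convex_def epigraph_ereal_def)
  then have "(1 - t) *\<^sub>R (x, r) + t *\<^sub>R (y, s) \<in> epigraph_ereal h"
    using assms(4,5) by (intro convexD) auto
  then show ?thesis by (simp add: epigraph_ereal_def)
qed

text \<open>As \<open>h\<close> need not be differentiable, \<open>p\<close> is compared with points
  of the segment towards \<open>v\<close>: convexity bounds \<open>h\<close> there, and after
  division by \<open>t\<close> the remainder \<open>t * K (v - p)\<close> vanishes in the limit. The
  exact expansion assumed of \<open>q\<close> fits both the proximal objective and the augmented
  Lagrangian.\<close>

lemma arg_min_add_quadratic_subgradient:
  fixes h :: "'a::real_inner \<Rightarrow> ereal"
  assumes h: "closed_proper_convex h"
    and min: "is_arg_min (\<lambda>v. h v + ereal (q v)) (\<lambda>v. True) p"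
    and q: "\<And>d t. q (p + t *\<^sub>R d) = q p + t * (c \<bullet> d) + t\<^sup>2 * K d"
  shows "- c \<in> subdifferential h p"
proof -
  have le: "h p + ereal (q p) \<le> h v + ereal (q v)" for v
    using min by (auto simp: is_arg_min_def not_less)
  have pr: "h v \<noteq> -\<infinity>" for v
    using h by (auto simp: closed_proper_convex_def proper_fun_def)
  obtain v0 where v0: "h v0 \<noteq> \<infinity>"
    using h by (auto simp: closed_proper_convex_def proper_fun_def)
  have "h p \<noteq> \<infinity>"
    using le[of v0] v0 by (cases "h v0") auto
  then obtain r where r: "h p = ereal r"
    using pr by (rule_tac ereal_finite_cases) auto
  have "h v \<ge> h p + ereal (- c \<bullet> (v - p))" for v
  proof (cases "h v = \<infinity>")
    case False
    then obtain s where s: "h v = ereal s"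
      using pr by (rule_tac ereal_finite_cases) auto
    have "r - s - c \<bullet> (v - p) \<le> t * K (v - p)" if t: "0 < t" "t < 1" for t
    proof -
      have eq: "(1 - t) *\<^sub>R p + t *\<^sub>R v = p + t *\<^sub>R (v - p)"
        by (simp add: algebra_simps)
      have "h (p + t *\<^sub>R (v - p)) \<le> ereal ((1 - t) * r + t * s)"
        using closed_proper_convex_convex_comb[OF h, of p r v s t] r s t by (simp add: eq)
      then have "ereal (r + q p) \<le> ereal ((1 - t) * r + t * s + q (p + t *\<^sub>R (v - p)))"
        using le[of "p + t *\<^sub>R (v - p)"] r by (cases "h (p + t *\<^sub>R (v - p))") auto
      then have "t * (r - s - c \<bullet> (v - p)) \<le> t * (t * K (v - p))"
        unfolding q by (simp add: algebra_simps power2_eq_square)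
      then show ?thesis using t by simp
    qed
    from real_nonpos_if_le_multiples[OF this] show ?thesis
      by (simp add: r s)
  qed simp
  then show ?thesis
    by (simp add: subdifferential_def r)
qed

section \<open>Proximal points by the direct method, and the Riesz representation\<close>

text \<open>The parallelogram law, arranged as the midpoint gap of the squared norm; it turns nearly
  optimal values into nearby points.\<close>

lemma half_parallelogram:
  fixes a b :: "'a::real_inner"
  shows "4 * ((norm a)\<^sup>2 / 2 + (norm b)\<^sup>2 / 2 - (norm ((1/2) *\<^sub>R (a + b)))\<^sup>2) = (norm (a - b))\<^sup>2"
  by (simp only: power2_norm_eq_inner inner_simps inner_commute[of b a]) (simp add: field_simps)

text \<open>Strong convexity of the quadratic makes a minimizing sequence Cauchy, and the closed
  epigraph carries the infimum over to its limit.\<close>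

lemma ex_prox:
  fixes h :: "'a::{real_inner,complete_space} \<Rightarrow> ereal"
  assumes h: "closed_proper_convex h" and \<gamma>: "\<gamma> > 0"
    and bound: "\<And>v. ereal c \<le> h v + ereal (1 / (2 * \<gamma>) * (norm (v - w))\<^sup>2)"
  shows "\<exists>p. is_arg_min (\<lambda>v. h v + ereal (1 / (2 * \<gamma>) * (norm (v - w))\<^sup>2)) (\<lambda>v. True) p"
proof -
  define q where "q v = 1 / (2 * \<gamma>) * (norm (v - w))\<^sup>2" for v
  \<comment> \<open>Collecting the reals that dominate some objective value makes the infimum
    \<open>m\<close> a real number and keeps the estimates below in real arithmetic.\<close>
  define S where "S = {s. \<exists>v. h v \<le> ereal (s - q v)}"
  have lb: "c \<le> s" if "s \<in> S" for s
  proof -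
    from that obtain v where v: "h v \<le> ereal (s - q v)" by (auto simp: S_def)
    with bound[of v] show ?thesis unfolding q_def[symmetric] by (cases "h v") auto
  qed
  then have bdd: "bdd_below S" by (rule bdd_belowI)
  obtain v0 where v0: "h v0 \<noteq> \<infinity>" "h v0 \<noteq> -\<infinity>"
    using h by (auto simp: closed_proper_convex_def proper_fun_def)
  then obtain r0 where "h v0 = ereal r0" by (rule_tac ereal_finite_cases) auto
  then have "r0 + q v0 \<in> S" unfolding S_def by (intro CollectI exI[of _ v0]) simp
  then have ne: "S \<noteq> {}" by auto
  define m where "m = Inf S"
  have "\<exists>v. h v \<le> ereal (m + inverse (Suc n) - q v)" for n
  proof -
    have "\<exists>s\<in>S. s < m + inverse (Suc n)"
      using ne bdd by (subst cInf_less_iff[symmetric]) (auto simp: m_def)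
    then obtain s v where "s < m + inverse (Suc n)" "h v \<le> ereal (s - q v)"
      by (auto simp: S_def)
    then have "h v \<le> ereal (m + inverse (Suc n) - q v)"
      by (elim order_trans) simp
    then show ?thesis ..
  qed
  then obtain X where X: "\<And>n. h (X n) \<le> ereal (m + inverse (Suc n) - q (X n))"
    by metis
  have mid_arith: "m \<le> (1 - 1/2) * (m + a - b) + 1/2 * (m + c - d) + e \<Longrightarrow> b / 2 + d / 2 - e \<le> (a + c) / 2"
    for a b c d e :: real
    by (simp add: field_simps)
  \<comment> \<open>The objective at the midpoint is not below \<open>m\<close>, while both ends are
    within \<open>inverse (Suc i)\<close> and \<open>inverse (Suc j)\<close> of \<open>m\<close>.
    The midpoint gap of the quadratic, which is the squared distance over
    \<open>8 * \<gamma>\<close>, must therefore be small.\<close>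
  have mid: "(norm (X i - X j))\<^sup>2 \<le> 4 * \<gamma> * (inverse (Suc i) + inverse (Suc j))" for i j
  proof -
    define M where "M = (1 - 1/2) *\<^sub>R X i + (1/2) *\<^sub>R X j"
    have "h M \<le> ereal ((1 - 1/2) * (m + inverse (Suc i) - q (X i))
        + 1/2 * (m + inverse (Suc j) - q (X j)))"
      unfolding M_def by (rule closed_proper_convex_convex_comb[OF h X X]) auto
    then have "(1 - 1/2) * (m + inverse (Suc i) - q (X i))
        + 1/2 * (m + inverse (Suc j) - q (X j)) + q M \<in> S"
      unfolding S_def by (intro CollectI exI[of _ M]) simp
    then have "m \<le> (1 - 1/2) * (m + inverse (Suc i) - q (X i))
        + 1/2 * (m + inverse (Suc j) - q (X j)) + q M"
      unfolding m_def using bdd by (rule cInf_lower)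
    then have "q (X i) / 2 + q (X j) / 2 - q M \<le> (inverse (Suc i) + inverse (Suc j)) / 2"
      by (rule mid_arith)
    moreover have "q (X i) / 2 + q (X j) / 2 - q M = (norm (X i - X j))\<^sup>2 / (8 * \<gamma>)"
    proof -
      have Mw: "M - w = (1/2) *\<^sub>R ((X i - w) + (X j - w))"
      proof -
        have "w = (1/2) *\<^sub>R (w + w)" by (simp flip: scaleR_2)
        then have "M - w = M - (1/2) *\<^sub>R (w + w)" by simp
        then show ?thesis by (simp add: M_def algebra_simps)
      qed
      have dd: "X i - X j = (X i - w) - (X j - w)" by simp
      show ?thesis unfolding q_def Mw dd half_parallelogram[symmetric] using \<gamma>
        by (simp add: field_simps)
    qed
    ultimately have "(norm (X i - X j))\<^sup>2 / (8 * \<gamma>) \<le> (inverse (Suc i) + inverse (Suc j)) / 2"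
      by (simp only:)
    then have "(norm (X i - X j))\<^sup>2 \<le> (inverse (Suc i) + inverse (Suc j)) / 2 * (8 * \<gamma>)"
      using \<gamma> by (intro pos_divide_le_eq[THEN iffD1]) simp_all
    also have "\<dots> = 4 * \<gamma> * (inverse (Suc i) + inverse (Suc j))" by (simp add: algebra_simps)
    finally show ?thesis .
  qed
  have "Cauchy X"
  proof (rule metric_CauchyI)
    fix e :: real assume e: "e > 0"
    then have e2: "e\<^sup>2 / (8 * \<gamma>) > 0" using \<gamma> by simp
    then obtain N where N: "inverse (real (Suc N)) < e\<^sup>2 / (8 * \<gamma>)"
      using reals_Archimedean by blast
    show "\<exists>N. \<forall>i\<ge>N. \<forall>j\<ge>N. dist (X i) (X j) < e"
    proof (intro exI allI impI)
      fix i j assume ij: "i \<ge> N" "j \<ge> N"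
      have "inverse (real (Suc i)) \<le> inverse (real (Suc N))" "inverse (real (Suc j)) \<le> inverse (real (Suc N))"
        using ij by auto
      then have "inverse (Suc i) + inverse (Suc j) < 2 * (e\<^sup>2 / (8 * \<gamma>))"
        using N by linarith
      then have "4 * \<gamma> * (inverse (Suc i) + inverse (Suc j)) < e\<^sup>2"
        using \<gamma> by (simp add: pos_less_divide_eq mult.commute)
      with mid[of i j] have "(norm (X i - X j))\<^sup>2 < e\<^sup>2" by linarith
      then show "dist (X i) (X j) < e"
        using e by (simp add: dist_norm power2_less_imp_less)
    qed
  qed
  then obtain p where p: "X \<longlonglongrightarrow> p"
    using Cauchy_convergent convergent_def by blast
  have q: "(\<lambda>n. q (X n)) \<longlonglongrightarrow> q p"
    unfolding q_def by (intro tendsto_intros p)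
  have "(\<lambda>n. m + inverse (Suc n) - q (X n)) \<longlonglongrightarrow> m + 0 - q p"
    by (intro tendsto_intros q LIMSEQ_inverse_real_of_nat)
  \<comment> \<open>These pairs lie in the epigraph, so its closedness acts as lower semicontinuity
    of \<open>h\<close> at \<open>p\<close>.\<close>
  then have lim: "(\<lambda>n. (X n, m + inverse (Suc n) - q (X n))) \<longlonglongrightarrow> (p, m + 0 - q p)"
    by (intro tendsto_Pair p)
  have "closed (epigraph_ereal h)"
    using h by (simp add: closed_proper_convex_def)
  from closed_sequentially[OF this _ lim] X have "(p, m + 0 - q p) \<in> epigraph_ereal h"
    by (simp add: epigraph_ereal_def)
  then have hp: "h p \<le> ereal (m - q p)"
    by (simp add: epigraph_ereal_def)
  have "h p + ereal (q p) \<le> h v + ereal (q v)" for v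
  proof (cases "h v")
    case (real s)
    then have "s + q v \<in> S" unfolding S_def by (intro CollectI exI[of _ v]) simp
    then have "m \<le> s + q v" unfolding m_def using bdd by (rule cInf_lower)
    moreover have "h p + ereal (q p) \<le> ereal m" using hp by (cases "h p") auto
    ultimately show ?thesis by (simp add: real order_trans[of _ "ereal m"])
  next
    case MInf
    then show ?thesis using h by (auto simp: closed_proper_convex_def proper_fun_def)
  qed auto
  then show ?thesis
    by (auto simp: is_arg_min_def q_def not_less)
qed

text \<open>First-order condition at the minimizer, where the quadratic has gradient
  \<open>(1 / \<gamma>) *\<^sub>R (p - w)\<close>. Assuming a bare lower bound on the objective
  allows the use for a linear functional that has no representing vector yet.\<close>

lemma prox_subgradient_of_bound:
  fixes h :: "'a::{real_inner,complete_space} \<Rightarrow> ereal"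
  assumes h: "closed_proper_convex h" and \<gamma>: "\<gamma> > 0"
    and bound: "\<And>v. ereal c \<le> h v + ereal (1 / (2 * \<gamma>) * (norm (v - w))\<^sup>2)"
  shows "(1 / \<gamma>) *\<^sub>R (w - prox \<gamma> h w) \<in> subdifferential h (prox \<gamma> h w)"
proof -
  let ?p = "prox \<gamma> h w" and ?q = "\<lambda>v. 1 / (2 * \<gamma>) * (norm (v - w))\<^sup>2"
  have min: "is_arg_min (\<lambda>v. h v + ereal (?q v)) (\<lambda>v. True) ?p"
    using ex_prox[OF assms] unfolding prox_def arg_min_def by (rule someI_ex)
  have "- ((1 / \<gamma>) *\<^sub>R (?p - w)) \<in> subdifferential h ?p"
  proof (rule arg_min_add_quadratic_subgradient[OF h min, where K = "\<lambda>d. (norm d)\<^sup>2 / (2 * \<gamma>)"])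
    fix d t
    have "?p + t *\<^sub>R d - w = (?p - w) + t *\<^sub>R d" by simp
    then show "?q (?p + t *\<^sub>R d) = ?q ?p + t * ((1 / \<gamma>) *\<^sub>R (?p - w) \<bullet> d) + t\<^sup>2 * ((norm d)\<^sup>2 / (2 * \<gamma>))"
      using \<gamma> by (simp only: power2_norm_eq_inner inner_simps)
        (simp add: field_simps inner_commute power2_eq_square)
  qed
  moreover have "- ((1 / \<gamma>) *\<^sub>R (?p - w)) = (1 / \<gamma>) *\<^sub>R (w - ?p)"
    by (simp add: algebra_simps)
  ultimately show ?thesis by simp
qed

text \<open>Completing the square shows that an affine minorant plus the quadratic is bounded
  below.\<close>

lemma prox_subgradient:
  fixes h :: "'a::{real_inner,complete_space} \<Rightarrow> ereal"
  assumes h: "closed_proper_convex h" and \<gamma>: "\<gamma> > 0"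
    and minorant: "\<And>v. ereal (a \<bullet> v + c) \<le> h v"
  shows "(1 / \<gamma>) *\<^sub>R (w - prox \<gamma> h w) \<in> subdifferential h (prox \<gamma> h w)"
proof (rule prox_subgradient_of_bound[OF h \<gamma>])
  fix v
  have "0 \<le> (norm (v - w + \<gamma> *\<^sub>R a))\<^sup>2" by simp
  also have "\<dots> = (norm (v - w))\<^sup>2 + 2 * \<gamma> * (a \<bullet> v - a \<bullet> w) + \<gamma>\<^sup>2 * (a \<bullet> a)"
    by (simp only: power2_norm_eq_inner inner_simps)
      (simp add: algebra_simps inner_commute power2_eq_square)
  finally have "(a \<bullet> w - \<gamma> / 2 * (a \<bullet> a) + c) \<le> a \<bullet> v + c + 1 / (2 * \<gamma>) * (norm (v - w))\<^sup>2"
    using \<gamma> by (simp add: field_simps power2_eq_square)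
  then have "ereal (a \<bullet> w - \<gamma> / 2 * (a \<bullet> a) + c)
      \<le> ereal (a \<bullet> v + c) + ereal (1 / (2 * \<gamma>) * (norm (v - w))\<^sup>2)"
    by simp
  also have "\<dots> \<le> h v + ereal (1 / (2 * \<gamma>) * (norm (v - w))\<^sup>2)"
    by (intro add_right_mono minorant)
  finally show "ereal (a \<bullet> w - \<gamma> / 2 * (a \<bullet> a) + c)
      \<le> h v + ereal (1 / (2 * \<gamma>) * (norm (v - w))\<^sup>2)" .
qed

text \<open>The representing vector is the minimizer of \<open>- l v + (norm v)\<^sup>2 / 2\<close>.\<close>

lemma riesz_representation:
  fixes l :: "'a::{real_inner,complete_space} \<Rightarrow> real"
  assumes "bounded_linear l"
  shows "\<exists>p. \<forall>v. l v = p \<bullet> v"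
proof -
  interpret bounded_linear l by fact
  let ?h = "\<lambda>v. ereal (- l v)"
  have epi: "epigraph_ereal ?h = {u. - l (fst u) \<le> snd u}"
    by (auto simp: epigraph_ereal_def)
  have "closed {u. - l (fst u) \<le> snd u}"
    by (intro closed_Collect_le continuous_intros continuous_on continuous_on_fst)
  moreover have "convex {u. - l (fst u) \<le> snd u}"
  proof (rule convexI)
    fix x y :: "'a \<times> real" and u v :: real
    assume "x \<in> {u. - l (fst u) \<le> snd u}" "y \<in> {u. - l (fst u) \<le> snd u}" and uv: "0 \<le> u" "0 \<le> v"
    then have "u * (- l (fst x)) \<le> u * snd x" "v * (- l (fst y)) \<le> v * snd y"
      by (intro mult_left_mono; simp)+
    then show "u *\<^sub>R x + v *\<^sub>R y \<in> {u. - l (fst u) \<le> snd u}"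
      by (simp add: add scaleR)
  qed
  ultimately have h: "closed_proper_convex ?h"
    by (simp add: closed_proper_convex_def epi proper_fun_def)
  obtain K where K: "\<And>v. norm (l v) \<le> norm v * K" using bounded by blast
  have bound: "ereal (- K\<^sup>2 / 2) \<le> ?h v + ereal (1 / (2 * 1) * (norm (v - 0))\<^sup>2)" for v
  proof -
    have "l v \<le> norm v * K" using K[of v] by simp
    moreover have "0 \<le> (norm v - K)\<^sup>2" by simp
    ultimately show ?thesis by (simp add: power2_eq_square algebra_simps)
  qed
  let ?p = "prox 1 ?h 0"
  have "- ?p \<in> subdifferential ?h ?p"
    using prox_subgradient_of_bound[OF h _ bound] by simp
  then have le: "l (v - ?p) \<le> ?p \<bullet> (v - ?p)" for v
    using subgradient_ineq[of "- ?p" ?h ?p "- l ?p" v] by (simp add: diff)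
  \<comment> \<open>The arguments \<open>?p + v\<close> and \<open>?p - v\<close> give the two
    opposite inequalities.\<close>
  have "l v = ?p \<bullet> v" for v
    using le[of "?p + v"] le[of "?p - v"] by (simp add: neg)
  then show ?thesis by blast
qed

section \<open>Adjoints and conjugates\<close>

text \<open>\<open>adjoint\<close> is a choice operator, so its identity becomes available once some
  adjoint is known to exist; representing the functional \<open>\<lambda>x. A x \<bullet> w\<close>
  for each \<open>w\<close> provides one.\<close>

lemma inner_adjoint:
  fixes A :: "'a::{real_inner,complete_space} \<Rightarrow>\<^sub>L 'g::real_inner"
  shows "x \<bullet> adjoint A w = A x \<bullet> w"
proof -
  have "\<exists>p. \<forall>x. A x \<bullet> w = p \<bullet> x" for w
    by (rule riesz_representation) (intro bounded_linear_intros)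
  then obtain A' where "\<And>w x. A x \<bullet> w = A' w \<bullet> x" by metis
  then have "\<exists>A'. \<forall>x w. A x \<bullet> w = x \<bullet> A' w" by (metis inner_commute)
  then have "\<forall>x w. A x \<bullet> w = x \<bullet> adjoint A w" unfolding adjoint_def by (rule someI_ex)
  then show ?thesis by simp
qed

lemma adjoint_blinfun_diff:
  fixes A :: "'a::{real_inner,complete_space} \<Rightarrow>\<^sub>L 'g::real_inner"
  shows "adjoint A (v - w) = adjoint A v - adjoint A w"
proof -
  have "x \<bullet> (adjoint A (v - w) - (adjoint A v - adjoint A w)) = 0" for x
    by (simp add: inner_diff_right inner_adjoint)
  from this[of "adjoint A (v - w) - (adjoint A v - adjoint A w)"] show ?thesis by simp
qed

lemma fenchel_young:
  "ereal (u \<bullet> x) - h x \<le> fenchel_conjugate h u"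
  unfolding fenchel_conjugate_def by (rule SUP_upper) simp

text \<open>This replaces the Fenchel--Moreau theorem: the proximal point \<open>y'\<close> of \<open>y + u\<close> carries the subgradient
  \<open>y + u - y'\<close>, and monotonicity of the subdifferential of the conjugate forces \<open>y' = y\<close>.\<close>

lemma subgradient_conjugate_imp_subgradient:
  fixes h :: "'a::{real_inner,complete_space} \<Rightarrow> ereal"
  assumes h: "closed_proper_convex h" and y: "y \<in> subdifferential (fenchel_conjugate h) u"
  shows "u \<in> subdifferential h y"
proof -
  obtain r where r: "fenchel_conjugate h u = ereal r" using y by (rule subgradient_finite)
  have minorant: "ereal (u \<bullet> v + - r) \<le> h v" for v
    using fenchel_young[of u v h] r by (cases "h v") auto
  define y' where "y' = prox 1 h (y + u)"
  define v where "v = y + u - y'"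
  have v: "v \<in> subdifferential h y'"
    using prox_subgradient[OF h _ minorant, of 1 "y + u"] by (simp add: v_def y'_def)
  then obtain s where s: "h y' = ereal s" by (rule subgradient_finite)
  \<comment> \<open>Because \<open>v\<close> is a subgradient at \<open>y'\<close>, the supremum
    defining the conjugate is bounded by its term at \<open>y'\<close>.\<close>
  have "fenchel_conjugate h v \<le> ereal (v \<bullet> y' - s)"
    unfolding fenchel_conjugate_def
  proof (rule SUP_least)
    fix x
    have "h y' + ereal (v \<bullet> (x - y')) \<le> h x"
      using v by (simp add: subdifferential_def)
    then show "ereal (v \<bullet> x) - h x \<le> ereal (v \<bullet> y' - s)"
      by (cases "h x") (auto simp: s inner_diff_right)
  qed
  moreover have "ereal r + ereal (y \<bullet> (v - u)) \<le> fenchel_conjugate h v"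
    using y r by (simp add: subdifferential_def)
  ultimately have "ereal (r + y \<bullet> (v - u)) \<le> ereal (v \<bullet> y' - s)"
    by (metis order_trans plus_ereal.simps(1))
  moreover have "u \<bullet> y' - s \<le> r"
    using fenchel_young[of u y' h] r s by simp
  \<comment> \<open>Here \<open>v - u = y - y'\<close>, so the sum of the two inequalities reduces
    to the squared distance.\<close>
  ultimately have "(y - y') \<bullet> (y - y') \<le> 0"
    by (simp add: v_def inner_simps inner_commute algebra_simps)
  then have "y' = y" by (metis eq_iff_diff_eq_0 inner_gt_zero_iff not_le)
  then show ?thesis using v by (simp add: v_def)
qed

section \<open>Monotonicity bounds from strong convexity and from Lipschitz gradients\<close>

lemma subgradient_monotone:
  assumes "p \<in> subdifferential h x" "q \<in> subdifferential h y"
  shows "0 \<le> (x - y) \<bullet> (p - q)"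
proof -
  obtain r s where "h x = ereal r" "h y = ereal s"
    using assms by (meson subgradient_finite)
  with subgradient_ineq[OF assms(1), of r y s] subgradient_ineq[OF assms(2), of s x r]
  show ?thesis by (simp add: inner_simps inner_commute)
qed

text \<open>Combine the subgradient inequality and strong convexity at an interior point of the
  segment, then divide by \<open>t\<close>; the factor \<open>1 - t\<close> tends to 1, so the full
  modulus survives.\<close>

lemma strongly_convex_subgradient_ineq:
  assumes h: "strongly_convex \<mu> h"
    and p: "p \<in> subdifferential h x" and r: "h x = ereal r" and s: "h y = ereal s"
  shows "r + p \<bullet> (y - x) + \<mu> / 2 * (norm (x - y))\<^sup>2 \<le> s"
proof -
  have "r + p \<bullet> (y - x) + \<mu> / 2 * (norm (x - y))\<^sup>2 - s \<le> t * (\<mu> / 2 * (norm (x - y))\<^sup>2)"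
    if t: "0 < t" "t < 1" for t
  proof -
    let ?m = "(1 - t) *\<^sub>R x + t *\<^sub>R y"
    have eq: "?m - x = t *\<^sub>R (y - x)" by (simp add: algebra_simps)
    have "h x + ereal (p \<bullet> (?m - x)) \<le> h ?m"
      using p unfolding subdifferential_def by blast
    then have "ereal (r + t * (p \<bullet> (y - x))) \<le> h ?m"
      by (simp add: eq r)
    then have "ereal (r + t * (p \<bullet> (y - x))) + ereal (\<mu> / 2 * t * (1 - t) * (norm (x - y))\<^sup>2)
        \<le> h ?m + ereal (\<mu> / 2 * t * (1 - t) * (norm (x - y))\<^sup>2)"
      by (rule add_right_mono)
    also have "\<dots> \<le> ereal (1 - t) * h x + ereal t * h y"
      using h t unfolding strongly_convex_def by blast
    finally have "t * (r + p \<bullet> (y - x) + \<mu> / 2 * (norm (x - y))\<^sup>2 - s)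
        \<le> t * (t * (\<mu> / 2 * (norm (x - y))\<^sup>2))"
      by (simp add: r s field_simps)
    then show ?thesis using t by simp
  qed
  from real_nonpos_if_le_multiples[OF this] show ?thesis by simp
qed

lemma strongly_convex_strongly_monotone:
  assumes h: "strongly_convex \<mu> h"
    and p: "p \<in> subdifferential h x" and q: "q \<in> subdifferential h y"
  shows "\<mu> * (norm (x - y))\<^sup>2 \<le> (x - y) \<bullet> (p - q)"
proof -
  obtain r s where "h x = ereal r" "h y = ereal s"
    using p q by (meson subgradient_finite)
  with strongly_convex_subgradient_ineq[OF h p, of r y s]
    strongly_convex_subgradient_ineq[OF h q, of s x r]
  show ?thesis by (simp add: inner_simps inner_commute norm_minus_commute[of y x])
qed

text \<open>The descent lemma. The auxiliary \<open>\<phi>\<close> is the error along the segment;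
  its derivative is nonpositive by Cauchy-Schwarz and the Lipschitz bound.\<close>

lemma lipschitz_gradient_upper_bound:
  fixes H :: "'a::real_inner \<Rightarrow> real"
  assumes H: "\<And>x. (H has_derivative (\<lambda>v. grad x \<bullet> v)) (at x)"
    and L: "L-lipschitz_on UNIV grad"
  shows "H (x + d) \<le> H x + grad x \<bullet> d + L / 2 * (norm d)\<^sup>2"
proof -
  define \<phi> where "\<phi> t = H (x + t *\<^sub>R d) - t * (grad x \<bullet> d) - L / 2 * (norm d)\<^sup>2 * t\<^sup>2" for t
  have D: "(\<phi> has_real_derivative (grad (x + t *\<^sub>R d) \<bullet> d - grad x \<bullet> d - L * (norm d)\<^sup>2 * t)) (at t)" for t
  proof -
    have "((\<lambda>t. H (x + t *\<^sub>R d)) has_derivative (\<lambda>s. grad (x + t *\<^sub>R d) \<bullet> (s *\<^sub>R d))) (at t)"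
      by (rule has_derivative_compose[OF _ H]) (auto intro!: derivative_eq_intros)
    then have "((\<lambda>t. H (x + t *\<^sub>R d)) has_real_derivative (grad (x + t *\<^sub>R d) \<bullet> d)) (at t)"
      by (simp add: has_field_derivative_def mult_commute_abs)
    then show ?thesis
      unfolding \<phi>_def by (auto intro!: derivative_eq_intros)
  qed
  have "\<phi> 1 \<le> \<phi> 0"
  proof (rule DERIV_nonpos_imp_nonincreasing[of 0 1])
    fix t :: real assume t: "0 \<le> t" "t \<le> 1"
    have "(grad (x + t *\<^sub>R d) - grad x) \<bullet> d \<le> norm (grad (x + t *\<^sub>R d) - grad x) * norm d"
      by (rule norm_cauchy_schwarz)
    also have "\<dots> \<le> (L * norm (t *\<^sub>R d)) * norm d"
      using lipschitz_on_normD[OF L, of "x + t *\<^sub>R d" x] by (intro mult_right_mono) auto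
    also have "\<dots> = L * (norm d)\<^sup>2 * t"
      using t by (simp add: power2_eq_square)
    finally have "grad (x + t *\<^sub>R d) \<bullet> d - grad x \<bullet> d - L * (norm d)\<^sup>2 * t \<le> 0"
      by (simp add: inner_diff_left)
    with D[of t] show "\<exists>y. (\<phi> has_real_derivative y) (at t) \<and> y \<le> 0" by blast
  qed simp
  then show ?thesis by (simp add: \<phi>_def)
qed

text \<open>Evaluate the affine minorant at \<open>x\<close> and the quadratic majorant at
  \<open>y\<close> in one common point, a gradient step away from \<open>y\<close>.\<close>

lemma lipschitz_gradient_subgradient_ineq:
  assumes \<beta>: "\<beta> > 0" and h: "lipschitz_gradient (1 / \<beta>) h"
    and p: "p \<in> subdifferential h x" and q: "q \<in> subdifferential h y"
    and r: "h x = ereal r" and s: "h y = ereal s"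
  shows "r + p \<bullet> (y - x) + \<beta> / 2 * (norm (p - q))\<^sup>2 \<le> s"
proof -
  obtain H grad where H: "\<And>x. h x = ereal (H x)"
      "\<And>x. (H has_derivative (\<lambda>v. grad x \<bullet> v)) (at x)" "(1 / \<beta>)-lipschitz_on UNIV grad"
    using h unfolding lipschitz_gradient_def by blast
  note ub = lipschitz_gradient_upper_bound[OF H(2,3)]
  \<comment> \<open>A subgradient of a differentiable function is its gradient: a step
    \<open>\<beta>\<close> along the difference \<open>e\<close> gains
    \<open>\<beta> * (e \<bullet> e)\<close>, but the descent lemma allows only half of
    that.\<close>
  have q_eq: "q = grad y"
  proof -
    define e where "e = q - grad y"
    have "H y + q \<bullet> (\<beta> *\<^sub>R e) \<le> H (y + \<beta> *\<^sub>R e)"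
      using subgradient_ineq[OF q H(1) H(1), of "y + \<beta> *\<^sub>R e"] by simp
    also have "\<dots> \<le> H y + grad y \<bullet> (\<beta> *\<^sub>R e) + 1 / \<beta> / 2 * (norm (\<beta> *\<^sub>R e))\<^sup>2"
      by (rule ub)
    finally have "\<beta> * (e \<bullet> e) \<le> \<beta> / 2 * (e \<bullet> e)"
      using \<beta> unfolding power2_norm_eq_inner
      by (simp add: e_def inner_diff_left algebra_simps)
    then have "e \<bullet> e \<le> 0" using \<beta> by simp
    then have "e = 0" by (metis inner_gt_zero_iff not_le)
    then show ?thesis by (simp add: e_def)
  qed
  \<comment> \<open>The step length \<open>\<beta>\<close> maximizes the linear gain minus the
    quadratic loss with constant \<open>1 / \<beta>\<close>, leaving the factor
    \<open>\<beta> / 2\<close>.\<close>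
  have "H x + p \<bullet> (y + \<beta> *\<^sub>R (p - q) - x) \<le> H (y + \<beta> *\<^sub>R (p - q))"
    using subgradient_ineq[OF p H(1) H(1)] .
  also have "\<dots> \<le> H y + q \<bullet> (\<beta> *\<^sub>R (p - q)) + 1 / \<beta> / 2 * (norm (\<beta> *\<^sub>R (p - q)))\<^sup>2"
    unfolding q_eq by (rule ub)
  also have "1 / \<beta> / 2 * (norm (\<beta> *\<^sub>R (p - q)))\<^sup>2 = \<beta> / 2 * (norm (p - q))\<^sup>2"
    using \<beta> by (simp add: power_mult_distrib power2_eq_square)
  finally have "H x + p \<bullet> (y - x) + \<beta> * ((p - q) \<bullet> (p - q)) - \<beta> / 2 * (norm (p - q))\<^sup>2 \<le> H y"
    by (simp add: inner_diff_left inner_diff_right inner_add_right algebra_simps)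
  then show ?thesis
    using H(1) r s by (simp flip: power2_norm_eq_inner)
qed

text \<open>Baillon-Haddad cocoercivity: the sum of the preceding inequality and the one with the
  two points exchanged.\<close>

lemma lipschitz_gradient_cocoercive:
  assumes \<beta>: "\<beta> > 0" and h: "lipschitz_gradient (1 / \<beta>) h"
    and p: "p \<in> subdifferential h x" and q: "q \<in> subdifferential h y"
  shows "\<beta> * (norm (p - q))\<^sup>2 \<le> (x - y) \<bullet> (p - q)"
proof -
  obtain r s where "h x = ereal r" "h y = ereal s"
    using p q by (meson subgradient_finite)
  with lipschitz_gradient_subgradient_ineq[OF \<beta> h p q, of r s]
    lipschitz_gradient_subgradient_ineq[OF \<beta> h q p, of s r]
  show ?thesis by (simp add: inner_simps inner_commute norm_minus_commute[of q p])
qed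

section \<open>Pairings and optimality conditions moved through the adjoints\<close>

lemma inner_adjoint_diff:
  fixes A :: "'a::{real_inner,complete_space} \<Rightarrow>\<^sub>L 'g::real_inner"
  shows "(x - y) \<bullet> (adjoint A v - adjoint A u) = (A x - A y) \<bullet> (v - u)"
  by (simp add: inner_adjoint blinfun.diff_right flip: adjoint_blinfun_diff)

lemma adjoint_pair_monotone:
  fixes A :: "'a::{real_inner,complete_space} \<Rightarrow>\<^sub>L 'g::real_inner"
  assumes "adjoint A v \<in> subdifferential f x" "adjoint A u \<in> subdifferential f y"
  shows "0 \<le> (A x - A y) \<bullet> (v - u)"
  using subgradient_monotone[OF assms] by (simp add: inner_adjoint_diff)

text \<open>Strong monotonicity controls \<open>norm (x - y)\<close>, and the operator norm passes
  this on to the images. Keeping \<open>(norm A)\<^sup>2\<close> as a factor on the right avoids a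
  division.\<close>

lemma adjoint_pair_strongly_convex:
  fixes A :: "'a::{real_inner,complete_space} \<Rightarrow>\<^sub>L 'g::real_inner"
  assumes "\<mu> \<ge> 0" "strongly_convex \<mu> f"
    and "adjoint A v \<in> subdifferential f x" "adjoint A u \<in> subdifferential f y"
  shows "\<mu> * (norm (A x - A y))\<^sup>2 \<le> (norm A)\<^sup>2 * ((A x - A y) \<bullet> (v - u))"
proof -
  have "norm (A x - A y) \<le> norm A * norm (x - y)"
    by (simp flip: blinfun.diff_right add: norm_blinfun)
  then have "(norm (A x - A y))\<^sup>2 \<le> (norm A * norm (x - y))\<^sup>2"
    by (intro power_mono) auto
  then have "\<mu> * (norm (A x - A y))\<^sup>2 \<le> \<mu> * ((norm A)\<^sup>2 * (norm (x - y))\<^sup>2)"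
    using assms(1) by (intro mult_left_mono) (auto simp: power_mult_distrib)
  also have "\<dots> = (norm A)\<^sup>2 * (\<mu> * (norm (x - y))\<^sup>2)" by simp
  also have "\<dots> \<le> (norm A)\<^sup>2 * ((x - y) \<bullet> (adjoint A v - adjoint A u))"
    by (intro mult_left_mono strongly_convex_strongly_monotone[OF assms(2-4)]) simp
  finally show ?thesis by (simp add: inner_adjoint_diff)
qed

text \<open>Cocoercivity controls the difference of the adjoint images; the constant \<alpha> bounds
  the adjoint from below and so recovers \<open>v - u\<close> itself.\<close>

lemma adjoint_pair_lipschitz_gradient:
  fixes A :: "'a::{real_inner,complete_space} \<Rightarrow>\<^sub>L 'g::real_inner"
  assumes "\<beta> > 0" "lipschitz_gradient (1 / \<beta>) f"
    and \<alpha>: "\<And>v. \<alpha> * (norm v)\<^sup>2 \<le> A (adjoint A v) \<bullet> v"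
    and "adjoint A v \<in> subdifferential f x" "adjoint A u \<in> subdifferential f y"
  shows "\<beta> * \<alpha> * (norm (v - u))\<^sup>2 \<le> (A x - A y) \<bullet> (v - u)"
proof -
  have "\<alpha> * (norm (v - u))\<^sup>2 \<le> (norm (adjoint A (v - u)))\<^sup>2"
    using \<alpha>[of "v - u"] by (simp add: power2_norm_eq_inner inner_adjoint)
  then have "\<beta> * (\<alpha> * (norm (v - u))\<^sup>2) \<le> \<beta> * (norm (adjoint A v - adjoint A u))\<^sup>2"
    using assms(1) by (simp add: adjoint_blinfun_diff)
  also have "\<dots> \<le> (x - y) \<bullet> (adjoint A v - adjoint A u)"
    by (rule lipschitz_gradient_cocoercive[OF assms(1,2,4,5)])
  finally show ?thesis by (simp add: inner_adjoint_diff)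
qed

text \<open>\<open>E\<close> and \<open>F\<close> have separate offsets because the
  \<open>y\<close>-update carries the relaxation term inside the quadratic only; the
  \<open>x\<close>-update takes both equal.\<close>

lemma arg_min_augmented_lagrangian:
  fixes B :: "'b::{real_inner,complete_space} \<Rightarrow>\<^sub>L 'g::real_inner"
  assumes g: "closed_proper_convex g"
    and min: "is_arg_min (\<lambda>v. g v - ereal (w \<bullet> E v) + ereal (\<gamma> / 2 * (norm (F v))\<^sup>2)) (\<lambda>v. True) p"
    and E: "\<And>v. E v = B v + e" and F: "\<And>v. F v = B v + e'"
  shows "adjoint B (w - \<gamma> *\<^sub>R F p) \<in> subdifferential g p"
proof -
  let ?q = "\<lambda>v. \<gamma> / 2 * (norm (F v))\<^sup>2 - w \<bullet> E v"
  have "g v - ereal (w \<bullet> E v) + ereal (\<gamma> / 2 * (norm (F v))\<^sup>2) = g v + ereal (?q v)" for v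
    by (cases "g v") auto
  with min have "is_arg_min (\<lambda>v. g v + ereal (?q v)) (\<lambda>v. True) p" by simp
  then have "- (- adjoint B (w - \<gamma> *\<^sub>R F p)) \<in> subdifferential g p"
  proof (rule arg_min_add_quadratic_subgradient[OF g, where K = "\<lambda>d. \<gamma> / 2 * (norm (B d))\<^sup>2"])
    fix d t
    have F': "F (p + t *\<^sub>R d) = F p + t *\<^sub>R B d" and E': "E (p + t *\<^sub>R d) = E p + t *\<^sub>R B d"
      by (simp_all add: E F blinfun.add_right blinfun.scaleR_right)
    have a: "- adjoint B (w - \<gamma> *\<^sub>R F p) \<bullet> d = \<gamma> * (F p \<bullet> B d) - w \<bullet> B d"
      by (simp add: inner_commute[of _ d] inner_adjoint inner_diff_right inner_commute)
    have b: "(norm (F p + t *\<^sub>R B d))\<^sup>2 = (norm (F p))\<^sup>2 + 2 * t * (F p \<bullet> B d) + t\<^sup>2 * (norm (B d))\<^sup>2"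
      by (simp only: power2_norm_eq_inner inner_simps inner_commute[of "B d" "F p"]) (simp add: power2_eq_square algebra_simps)
    show "?q (p + t *\<^sub>R d) = ?q p + t * (- adjoint B (w - \<gamma> *\<^sub>R F p) \<bullet> d) + t\<^sup>2 * (\<gamma> / 2 * (norm (B d))\<^sup>2)"
      unfolding F' E' a b by (simp add: inner_add_right algebra_simps)
  qed
  then show ?thesis by simp
qed

section \<open>The dual functions and fixed points of the reflected operator\<close>

text \<open>Makes every fact about \<open>dual_g\<close> available for
  \<open>dual_f\<close>.\<close>

lemma dual_f_eq_dual_g: "dual_f f A = dual_g f A 0"
  by (simp add: dual_f_def dual_g_def fun_eq_iff flip: zero_ereal_def)

lemma affine_le_dual_g:
  fixes B :: "'b::{real_inner,complete_space} \<Rightarrow>\<^sub>L 'g::{real_inner,complete_space}"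
  assumes "g x \<noteq> \<infinity>"
  shows "ereal ((B x - b) \<bullet> w) - g x \<le> dual_g g B b w"
proof -
  have "ereal (adjoint B w \<bullet> x) - g x \<le> fenchel_conjugate g (adjoint B w)"
    by (rule fenchel_young)
  then have "(ereal (B x \<bullet> w) - g x) - ereal (w \<bullet> b) \<le> dual_g g B b w"
    unfolding dual_g_def by (intro ereal_minus_mono) (auto simp: inner_commute[of _ x] inner_adjoint)
  then show ?thesis
    using assms by (cases "g x") (auto simp: inner_diff_left inner_commute algebra_simps)
qed

text \<open>The epigraph is an intersection of closed half-spaces. The subgradient \<open>q\<close>
  supplies a point where the dual function is finite, as the range of the adjoint could otherwise
  miss the domain of the conjugate.\<close>

lemma closed_proper_convex_dual_g:
  fixes B :: "'b::{real_inner,complete_space} \<Rightarrow>\<^sub>L 'g::{real_inner,complete_space}"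
  assumes g: "closed_proper_convex g" and q: "q \<in> subdifferential (dual_g g B b) v"
  shows "closed_proper_convex (dual_g g B b)"
proof -
  have pr: "g x \<noteq> -\<infinity>" for x
    using g by (auto simp: closed_proper_convex_def proper_fun_def)
  obtain x0 where x0: "g x0 \<noteq> \<infinity>"
    using g by (auto simp: closed_proper_convex_def proper_fun_def)
  have le_iff: "dual_g g B b w \<le> ereal r \<longleftrightarrow> (\<forall>x. g x \<noteq> \<infinity> \<longrightarrow> B x \<bullet> w - real_of_ereal (g x) \<le> r + w \<bullet> b)"
    for w r
  proof -
    have "dual_g g B b w \<le> ereal r \<longleftrightarrow> fenchel_conjugate g (adjoint B w) \<le> ereal (r + w \<bullet> b)"
      unfolding dual_g_def by (cases "fenchel_conjugate g (adjoint B w)") auto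
    also have "\<dots> \<longleftrightarrow> (\<forall>x. ereal (B x \<bullet> w) - g x \<le> ereal (r + w \<bullet> b))"
      unfolding fenchel_conjugate_def SUP_le_iff by (simp add: inner_commute[of "adjoint B w"] inner_adjoint)
    also have "\<dots> \<longleftrightarrow> (\<forall>x. g x \<noteq> \<infinity> \<longrightarrow> B x \<bullet> w - real_of_ereal (g x) \<le> r + w \<bullet> b)"
    proof (intro all_cong1)
      fix x
      show "ereal (B x \<bullet> w) - g x \<le> ereal (r + w \<bullet> b) \<longleftrightarrow>
          (g x \<noteq> \<infinity> \<longrightarrow> B x \<bullet> w - real_of_ereal (g x) \<le> r + w \<bullet> b)"
        using pr[of x] by (cases "g x") auto
    qed
    finally show ?thesis .
  qed
  \<comment> \<open>One half-space of the product space for each point of the domain of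
    \<open>g\<close>, with normal vector \<open>(B x - b, -1)\<close>.\<close>
  have epi: "epigraph_ereal (dual_g g B b)
      = (\<Inter>x\<in>{x. g x \<noteq> \<infinity>}. {u. (B x - b, -1) \<bullet> u \<le> real_of_ereal (g x)})"
    unfolding epigraph_ereal_def le_iff
    by (auto simp: inner_diff_left inner_commute algebra_simps)
  have "closed (epigraph_ereal (dual_g g B b))"
    unfolding epi by (intro closed_INT ballI closed_halfspace_le)
  moreover have "convex (epigraph_ereal (dual_g g B b))"
    unfolding epi by (intro convex_INT convex_halfspace_le)
  moreover have "proper_fun (dual_g g B b)"
  proof -
    have "dual_g g B b w \<noteq> -\<infinity>" for w
      using affine_le_dual_g[of g x0 B b w] x0 pr[of x0] by (cases "g x0") auto
    moreover have "dual_g g B b v \<noteq> \<infinity>"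
      using q by (auto elim: subgradient_finite)
    ultimately show ?thesis unfolding proper_fun_def by blast
  qed
  ultimately show ?thesis by (simp add: closed_proper_convex_def)
qed

text \<open>The proximal residual is a dual subgradient; the chain rule writes it as
  \<open>B y - b\<close>, and inverting the conjugate subdifferential turns \<open>y\<close> into a
  primal point.\<close>

lemma prox_dual_g:
  fixes B :: "'b::{real_inner,complete_space} \<Rightarrow>\<^sub>L 'g::{real_inner,complete_space}"
  assumes g: "closed_proper_convex g" and q: "q \<in> subdifferential (dual_g g B b) v"
    and chain: "\<And>v. subdifferential (dual_g g B b) v =
                  (\<lambda>u. B u - b) ` subdifferential (fenchel_conjugate g) (adjoint B v)"
    and \<gamma>: "\<gamma> > 0"
  obtains y where "adjoint B (prox \<gamma> (dual_g g B b) w) \<in> subdifferential g y"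
    and "w = prox \<gamma> (dual_g g B b) w + \<gamma> *\<^sub>R (B y - b)"
proof -
  let ?p = "prox \<gamma> (dual_g g B b) w"
  obtain x0 where x0: "g x0 \<noteq> \<infinity>" "g x0 \<noteq> -\<infinity>"
    using g by (auto simp: closed_proper_convex_def proper_fun_def)
  then obtain r where r: "g x0 = ereal r" by (cases "g x0") auto
  have "ereal ((B x0 - b) \<bullet> v + - r) \<le> dual_g g B b v" for v
    using affine_le_dual_g[of g x0 B b v] x0(1) by (simp add: r)
  then have "(1 / \<gamma>) *\<^sub>R (w - ?p) \<in> subdifferential (dual_g g B b) ?p"
    by (rule prox_subgradient[OF closed_proper_convex_dual_g[OF g q] \<gamma>])
  then obtain y where y: "y \<in> subdifferential (fenchel_conjugate g) (adjoint B ?p)"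
      "(1 / \<gamma>) *\<^sub>R (w - ?p) = B y - b"
    unfolding chain by blast
  have "w = ?p + \<gamma> *\<^sub>R (B y - b)"
    using \<gamma> by (simp flip: y(2))
  with subgradient_conjugate_imp_subgradient[OF g y(1)] that show thesis by blast
qed

text \<open>At a fixed point the two proximal points coincide. Adding their decompositions
  \<open>z = w + \<gamma> *\<^sub>R (B y - b)\<close> and
  \<open>2 *\<^sub>R w - z = w + \<gamma> *\<^sub>R A x\<close> then yields primal
  feasibility.\<close>

lemma T_PRS_fixed_point_kkt:
  fixes f :: "'a::{real_inner,complete_space} \<Rightarrow> ereal"
    and g :: "'b::{real_inner,complete_space} \<Rightarrow> ereal"
    and A :: "'a \<Rightarrow>\<^sub>L 'g::{real_inner,complete_space}" and B :: "'b \<Rightarrow>\<^sub>L 'g"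
  assumes f: "closed_proper_convex f" and g: "closed_proper_convex g"
    and dual_solution: "\<exists>v. 0 \<in> {p + q | p q. p \<in> subdifferential (dual_f f A) v \<and>
                                           q \<in> subdifferential (dual_g g B b) v}"
    and chain_f: "\<And>v. subdifferential (dual_f f A) v =
                      A ` subdifferential (fenchel_conjugate f) (adjoint A v)"
    and chain_g: "\<And>v. subdifferential (dual_g g B b) v =
                      (\<lambda>u. B u - b) ` subdifferential (fenchel_conjugate g) (adjoint B v)"
    and \<gamma>: "\<gamma> > 0"
    and fixed_point: "T_PRS \<gamma> (dual_f f A) (dual_g g B b) z = z"
  obtains w x y where "adjoint A w \<in> subdifferential f x" "adjoint B w \<in> subdifferential g y"
    and "A x + B y = b" "z = w + \<gamma> *\<^sub>R (B y - b)"
proof -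
  obtain v p q where p: "p \<in> subdifferential (dual_g f A 0) v" and q: "q \<in> subdifferential (dual_g g B b) v"
    using dual_solution unfolding dual_f_eq_dual_g by blast
  have chain_f': "subdifferential (dual_g f A 0) v =
      (\<lambda>u. A u - 0) ` subdifferential (fenchel_conjugate f) (adjoint A v)" for v
    using chain_f unfolding dual_f_eq_dual_g by simp
  define w where "w = prox \<gamma> (dual_g g B b) z"
  define w' where "w' = prox \<gamma> (dual_g f A 0) (2 *\<^sub>R w - z)"
  have "2 *\<^sub>R w' - (2 *\<^sub>R w - z) = z"
    using fixed_point unfolding T_PRS_def refl_prox_def w'_def w_def dual_f_eq_dual_g by simp
  then have "2 *\<^sub>R w' = 2 *\<^sub>R w" by (simp add: algebra_simps)
  then have w': "w' = w" by simp
  obtain y where y: "adjoint B w \<in> subdifferential g y" "z = w + \<gamma> *\<^sub>R (B y - b)"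
    using prox_dual_g[OF g q chain_g \<gamma>, of z] unfolding w_def by blast
  obtain x where x: "adjoint A w' \<in> subdifferential f x" "2 *\<^sub>R w - z = w' + \<gamma> *\<^sub>R (A x - 0)"
    using prox_dual_g[OF f p chain_f' \<gamma>, of "2 *\<^sub>R w - z"] unfolding w'_def by blast
  have "\<gamma> *\<^sub>R (A x + B y - b) = 0"
    using x(2) y(2) w' by (simp add: algebra_simps scaleR_2)
  then have "A x + B y = b" using \<gamma> by simp
  with x(1) y that show thesis unfolding w' by blast
qed

section \<open>Optimality of the iterates and the form of the associated sequence\<close>

lemma relaxed_admm_optimality:
  fixes f :: "'a::{real_inner,complete_space} \<Rightarrow> ereal"
    and g :: "'b::{real_inner,complete_space} \<Rightarrow> ereal"
    and A :: "'a \<Rightarrow>\<^sub>L 'g::{real_inner,complete_space}" and B :: "'b \<Rightarrow>\<^sub>L 'g"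
    and k :: nat
  assumes f: "closed_proper_convex f" and g: "closed_proper_convex g"
    and admm: "relaxed_admm f g A B b \<gamma> lam x y w"
  shows "adjoint A (w (int k) - \<gamma> *\<^sub>R (A (x (int k)) + B (y (int k)) - b)) \<in> subdifferential f (x (int k))"
    and "adjoint B (w (int k)) \<in> subdifferential g (y (int k))"
proof -
  \<comment> \<open>The iterates with index \<open>k\<close> are produced by step
    \<open>k - 1\<close>, which for \<open>k = 0\<close> is the initial step
    \<open>-1\<close>.\<close>
  define j where "j = int k - 1"
  have j: "-1 \<le> j" "int k = j + 1" by (auto simp: j_def)
  let ?c = "(2 * lam j - 1) *\<^sub>R (A (x j) + B (y j) - b)"
  have ymin: "is_arg_min (\<lambda>v. g v - ereal (w j \<bullet> (A (x j) + B v - b))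
             + ereal (\<gamma> / 2 * (norm (A (x j) + B v - b + ?c))\<^sup>2)) (\<lambda>v. True) (y (j + 1))"
    and w: "w (j + 1) = w j - \<gamma> *\<^sub>R (A (x j) + B (y (j + 1)) - b)
             - (\<gamma> * (2 * lam j - 1)) *\<^sub>R (A (x j) + B (y j) - b)"
    and xmin: "is_arg_min (\<lambda>u. f u - ereal (w (j + 1) \<bullet> (A u + B (y (j + 1)) - b))
             + ereal (\<gamma> / 2 * (norm (A u + B (y (j + 1)) - b))\<^sup>2)) (\<lambda>u. True) (x (j + 1))"
    using admm j(1) unfolding relaxed_admm_def by blast+
  show "adjoint A (w (int k) - \<gamma> *\<^sub>R (A (x (int k)) + B (y (int k)) - b)) \<in> subdifferential f (x (int k))"
    unfolding j(2)
    by (rule arg_min_augmented_lagrangian[OF f xmin, where e = "B (y (j + 1)) - b" and e' = "B (y (j + 1)) - b"])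
       simp_all
  \<comment> \<open>The multiplier update is exactly the argument of the adjoint in the optimality
    condition of the \<open>y\<close>-update.\<close>
  have "w (j + 1) = w j - \<gamma> *\<^sub>R (A (x j) + B (y (j + 1)) - b + ?c)"
    unfolding w by (simp add: scaleR_right_distrib)
  moreover have "adjoint B (w j - \<gamma> *\<^sub>R (A (x j) + B (y (j + 1)) - b + ?c)) \<in> subdifferential g (y (j + 1))"
    by (rule arg_min_augmented_lagrangian[OF g ymin, where e = "A (x j) - b" and e' = "A (x j) - b + ?c"])
       simp_all
  ultimately show "adjoint B (w (int k)) \<in> subdifferential g (y (int k))"
    unfolding j(2) by simp
qed

text \<open>Identifies \<open>z k\<close> as the point whose proximal point is to be
  \<open>w k\<close>: the residual in the multiplier update cancels the step of \<open>z\<close> up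
  to the term in \<open>B\<close>.\<close>

lemma admm_z_eq:
  assumes admm: "relaxed_admm f g A B b \<gamma> lam x y w"
    and z: "admm_z_sequence A B b \<gamma> lam x y w z"
  shows "z k = w (int k) + \<gamma> *\<^sub>R (B (y (int k)) - b)"
proof -
  have w: "w (j + 1) = w j - \<gamma> *\<^sub>R (A (x j) + B (y (j + 1)) - b)
             - (\<gamma> * (2 * lam j - 1)) *\<^sub>R (A (x j) + B (y j) - b)" if "j \<ge> -1" for j
    using admm that unfolding relaxed_admm_def by blast
  have init: "x (-1) = 0" "lam (-1) = 1/2" "z 0 = w (-1)"
    using admm z unfolding relaxed_admm_def admm_z_sequence_def by blast+
  show ?thesis
  proof (induction k)
    case 0
    \<comment> \<open>The initial values matter: \<open>lam (-1) = 1/2\<close> removes the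
      relaxation term and \<open>x (-1) = 0\<close> the term in \<open>A\<close>.\<close>
    show ?case using w[of "-1"] init by (simp add: algebra_simps)
  next
    case (Suc k)
    have z': "z (Suc k) = z k - (2 * \<gamma> * lam (int k)) *\<^sub>R (A (x (int k)) + B (y (int k)) - b)"
      using z unfolding admm_z_sequence_def by blast
    have "-1 \<le> int k" and k': "int (Suc k) = int k + 1" by simp_all
    then show ?case
      unfolding z' k' Suc w[OF \<open>-1 \<le> int k\<close>] by (simp add: algebra_simps)
  qed
qed

section \<open>Contraction estimates for one relaxed step, and linear convergence\<close>

text \<open>After expanding the square, everything rests on \<open>Z \<bullet> (P + Q)\<close> being
  the two monotone pairings plus \<gamma> times the squared norm of \<open>P + Q\<close>.\<close>

lemma relaxed_prs_step_norm:
  fixes W P Q :: "'g::real_inner"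
  assumes V: "V = W - \<gamma> *\<^sub>R P - \<gamma> *\<^sub>R Q" and Z: "Z = W + \<gamma> *\<^sub>R P"
  shows "(norm (Z - (2 * \<gamma> * l) *\<^sub>R (P + Q)))\<^sup>2
    = (norm Z)\<^sup>2 - 4 * l * (\<gamma> * (P \<bullet> W + Q \<bullet> V) + (1 - l) * (norm (\<gamma> *\<^sub>R (P + Q)))\<^sup>2)"
proof -
  define s where "s = (P + Q) \<bullet> (P + Q)"
  have ZS: "Z \<bullet> (P + Q) = P \<bullet> W + Q \<bullet> V + \<gamma> * s"
    unfolding V Z s_def by (simp add: inner_simps inner_commute algebra_simps)
  have "(norm (Z - (2 * \<gamma> * l) *\<^sub>R (P + Q)))\<^sup>2
      = (norm Z)\<^sup>2 - 4 * \<gamma> * l * (Z \<bullet> (P + Q)) + 4 * \<gamma>\<^sup>2 * l\<^sup>2 * ((P + Q) \<bullet> (P + Q))"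
    by (simp only: power2_norm_eq_inner inner_diff_left inner_diff_right inner_scaleR_left
          inner_scaleR_right inner_commute[of "P + Q" Z]) (simp add: power2_eq_square right_diff_distrib)
  moreover have "(norm (\<gamma> *\<^sub>R (P + Q)))\<^sup>2 = \<gamma>\<^sup>2 * s"
    by (simp only: power2_norm_eq_inner s_def inner_scaleR_left inner_scaleR_right) (simp add: power2_eq_square)
  ultimately show ?thesis
    unfolding ZS s_def[symmetric] by (simp add: power2_eq_square algebra_simps)
qed

text \<open>Coercivity in \<open>q\<close> and Cauchy-Schwarz give
  \<open>norm q \<le> N / \<mu> * norm v\<close>. Hence \<open>v + \<gamma> *\<^sub>R q\<close> is
  at most \<open>1 + \<gamma> * N / \<mu>\<close> times as long as \<open>v\<close>, the source of
  the squared denominator in the first two rates.\<close>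

lemma coercive_lipschitz_bound:
  fixes q v :: "'g::real_inner"
  assumes "\<mu> > 0" "\<gamma> > 0" "\<kappa> \<ge> 0" "N \<ge> 0"
    and q: "\<mu> * (norm q)\<^sup>2 \<le> N * (q \<bullet> v)" and v: "\<kappa> * (norm v)\<^sup>2 \<le> q \<bullet> v"
  shows "4 * \<gamma> * \<kappa> / (1 + \<gamma> * N / \<mu>)\<^sup>2 * (norm (v + \<gamma> *\<^sub>R q))\<^sup>2 \<le> 4 * \<gamma> * (q \<bullet> v)"
proof -
  define L where "L = 1 + \<gamma> * N / \<mu>"
  have L: "L > 0" unfolding L_def using assms by (simp add: add_pos_nonneg)
  have "norm q \<le> N / \<mu> * norm v"
  proof (cases "q = 0")
    case False
    have "\<mu> * (norm q)\<^sup>2 \<le> N * (norm q * norm v)"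
      using q mult_left_mono[OF norm_cauchy_schwarz \<open>N \<ge> 0\<close>, of q v] by linarith
    then have "norm q * (\<mu> * norm q) \<le> norm q * (N * norm v)"
      by (simp add: power2_eq_square algebra_simps)
    then have "\<mu> * norm q \<le> N * norm v" using False by simp
    then show ?thesis using \<open>\<mu> > 0\<close> by (simp add: field_simps)
  qed (use assms in simp)
  then have "\<gamma> * norm q \<le> \<gamma> * (N / \<mu> * norm v)"
    using \<open>\<gamma> > 0\<close> by (intro mult_left_mono) auto
  moreover have "norm (v + \<gamma> *\<^sub>R q) \<le> norm v + \<gamma> * norm q"
    using norm_triangle_ineq[of v "\<gamma> *\<^sub>R q"] \<open>\<gamma> > 0\<close> by simp
  ultimately have "norm (v + \<gamma> *\<^sub>R q) \<le> L * norm v"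
    by (simp add: L_def algebra_simps)
  then have "(norm (v + \<gamma> *\<^sub>R q))\<^sup>2 \<le> (L * norm v)\<^sup>2"
    by (intro power_mono) auto
  then have "(norm (v + \<gamma> *\<^sub>R q))\<^sup>2 / L\<^sup>2 \<le> (norm v)\<^sup>2"
    using L by (simp add: pos_divide_le_eq power_mult_distrib mult.commute)
  then have "\<kappa> * ((norm (v + \<gamma> *\<^sub>R q))\<^sup>2 / L\<^sup>2) \<le> \<kappa> * (norm v)\<^sup>2"
    using \<open>\<kappa> \<ge> 0\<close> by (rule mult_left_mono)
  also note v
  finally have "4 * \<gamma> * (\<kappa> * ((norm (v + \<gamma> *\<^sub>R q))\<^sup>2 / L\<^sup>2)) \<le> 4 * \<gamma> * (q \<bullet> v)"
    using \<open>\<gamma> > 0\<close> by (intro mult_left_mono) auto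
  then show ?thesis unfolding L_def[symmetric] by (simp add: mult.assoc)
qed

text \<open>The square of a sum of three norms is at most three times the sum of squares; this is
  the 3 in the last two rates.\<close>

lemma norm_add3_weighted:
  fixes E F G :: "'g::real_inner"
  assumes "0 \<le> m" "m \<le> a" "m \<le> b" "m \<le> c"
  shows "m / 3 * (norm (E + F + G))\<^sup>2 \<le> a * (norm E)\<^sup>2 + b * (norm F)\<^sup>2 + c * (norm G)\<^sup>2"
proof -
  have "norm (E + F + G) \<le> norm E + norm F + norm G"
    using norm_triangle_ineq[of "E + F" G] norm_triangle_ineq[of E F] by linarith
  then have "(norm (E + F + G))\<^sup>2 \<le> (norm E + norm F + norm G)\<^sup>2"
    by (intro power_mono) auto
  also have "\<dots> \<le> 3 * ((norm E)\<^sup>2 + (norm F)\<^sup>2 + (norm G)\<^sup>2)"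
    using zero_le_power2[of "norm E - norm F"] zero_le_power2[of "norm E - norm G"]
      zero_le_power2[of "norm F - norm G"]
    by (simp add: power2_eq_square algebra_simps)
  finally have "m / 3 * (norm (E + F + G))\<^sup>2 \<le> m / 3 * (3 * ((norm E)\<^sup>2 + (norm F)\<^sup>2 + (norm G)\<^sup>2))"
    using assms by (intro mult_left_mono) auto
  also have "\<dots> = m * (norm E)\<^sup>2 + m * (norm F)\<^sup>2 + m * (norm G)\<^sup>2"
    by (simp add: algebra_simps)
  also have "\<dots> \<le> a * (norm E)\<^sup>2 + b * (norm F)\<^sup>2 + c * (norm G)\<^sup>2"
    using assms by (intro add_mono mult_right_mono) auto
  finally show ?thesis .
qed

text \<open>Passes to the claimed factor, since a number in the unit interval is at most its square
  root. The slack between \<open>C\<close> and \<open>D\<close> admits a proved constant better than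
  the stated one.\<close>

lemma contraction_le_sqrt:
  fixes a s C D :: real
  assumes "0 \<le> a" "0 \<le> s" "0 \<le> C" "C \<le> D" "a \<le> (1 - D) * s"
  shows "a \<le> sqrt (1 - C) * s"
proof (cases "s = 0")
  case False
  have "a \<le> (1 - C) * s"
    using assms by (intro order_trans[OF assms(5)] mult_right_mono) auto
  \<comment> \<open>Needed because \<open>sqrt\<close> is negative at negative arguments; for
    \<open>s\<close> nonzero the sign of \<open>a\<close> rules this out.\<close>
  moreover have "0 \<le> 1 - C"
    using False assms(1,2) calculation by (smt (verit) mult_neg_pos)
  then have "1 - C \<le> sqrt (1 - C)"
    using \<open>0 \<le> C\<close> by (intro real_le_rsqrt) (simp add: power2_eq_square mult_left_le)
  then have "(1 - C) * s \<le> sqrt (1 - C) * s"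
    using assms(2) by (rule mult_right_mono)
  ultimately show ?thesis by linarith
qed (use assms in auto)

lemma converges_linearly_toI:
  fixes z :: "nat \<Rightarrow> 'g::real_normed_vector"
  assumes "c > 0"
    and step: "\<And>k. (norm (z (Suc k) - l))\<^sup>2 \<le> (1 - C k) * (norm (z k - l))\<^sup>2"
    and ev: "\<forall>\<^sub>F k in sequentially. c \<le> C k"
  shows "converges_linearly_to z l"
  unfolding converges_linearly_to_def
proof (intro exI conjI)
  \<comment> \<open>The maximum keeps the radicand nonnegative when \<open>c\<close> exceeds
    1.\<close>
  let ?q = "sqrt (max 0 (1 - c))"
  show "0 \<le> ?q" "?q < 1" using \<open>c > 0\<close> by auto
  show "\<forall>\<^sub>F k in sequentially. dist (z (Suc k)) l \<le> ?q * dist (z k) l"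
    using ev
  proof eventually_elim
    case (elim k)
    have "(norm (z (Suc k) - l))\<^sup>2 \<le> max 0 (1 - c) * (norm (z k - l))\<^sup>2"
      using elim by (intro order_trans[OF step] mult_right_mono) auto
    then have "sqrt ((norm (z (Suc k) - l))\<^sup>2) \<le> sqrt (max 0 (1 - c) * (norm (z k - l))\<^sup>2)"
      by (rule real_sqrt_le_mono)
    then show ?case by (simp add: dist_norm real_sqrt_mult)
  qed
qed

text \<open>Here \<open>W + \<gamma>P\<close> is the error of \<open>z\<^sup>k\<close> and \<open>W - \<gamma>P\<close> that of its first reflection; since the
  latter is no larger, contraction of the second reflection alone suffices. The cap \<open>min K 1\<close> avoids
  having to show that the contraction constant is at most one.\<close>

lemma relaxed_prs_step_contraction_second:
  fixes W P Q :: "'g::real_inner"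
  assumes V: "V = W - \<gamma> *\<^sub>R P - \<gamma> *\<^sub>R Q" and Z: "Z = W + \<gamma> *\<^sub>R P"
    and l: "0 < l" "l \<le> 1" and \<gamma>: "\<gamma> > 0" and PW: "0 \<le> P \<bullet> W"
    and K: "K * (norm (V + \<gamma> *\<^sub>R Q))\<^sup>2 \<le> 4 * \<gamma> * (Q \<bullet> V)"
  shows "(norm (Z - (2 * \<gamma> * l) *\<^sub>R (P + Q)))\<^sup>2 \<le> (1 - l * min K 1) * (norm Z)\<^sup>2"
proof -
  \<comment> \<open>\<open>V + \<gamma> *\<^sub>R Q\<close> equals
    \<open>W - \<gamma> *\<^sub>R P\<close>, and the loss in norm is paid for by the pairing
    \<open>P \<bullet> W\<close>.\<close>
  have refl: "(norm (V + \<gamma> *\<^sub>R Q))\<^sup>2 = (norm Z)\<^sup>2 - 4 * \<gamma> * (P \<bullet> W)"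
    unfolding V Z by (simp add: power2_norm_eq_inner inner_simps inner_commute algebra_simps)
  have "min K 1 * (norm (V + \<gamma> *\<^sub>R Q))\<^sup>2 \<le> K * (norm (V + \<gamma> *\<^sub>R Q))\<^sup>2"
    by (intro mult_right_mono) auto
  then have "min K 1 * (norm Z)\<^sup>2 \<le> 4 * \<gamma> * (Q \<bullet> V) + min K 1 * (4 * \<gamma> * (P \<bullet> W))"
    using K by (simp add: refl right_diff_distrib)
  also have "\<dots> \<le> 4 * \<gamma> * (Q \<bullet> V) + 1 * (4 * \<gamma> * (P \<bullet> W))"
    using PW \<gamma> by (intro add_left_mono mult_right_mono) auto
  finally have "l * (min K 1 * (norm Z)\<^sup>2) \<le> l * (4 * \<gamma> * (P \<bullet> W + Q \<bullet> V))"
    using l by (intro mult_left_mono) (auto simp: algebra_simps)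
  moreover have "0 \<le> 4 * l * ((1 - l) * (norm (\<gamma> *\<^sub>R (P + Q)))\<^sup>2)"
    using l by simp
  ultimately show ?thesis
    unfolding relaxed_prs_step_norm[OF V Z] by (simp only: ring_distribs)
qed

text \<open>The pairing \<open>P \<bullet> W\<close> alone yields the decrease; the other two terms
  of the identity are nonnegative and dropped.\<close>

lemma relaxed_prs_step_contraction_first:
  fixes W P Q :: "'g::real_inner"
  assumes V: "V = W - \<gamma> *\<^sub>R P - \<gamma> *\<^sub>R Q" and Z: "Z = W + \<gamma> *\<^sub>R P"
    and l: "0 < l" "l \<le> 1" and \<gamma>: "\<gamma> > 0" and QV: "0 \<le> Q \<bullet> V"
    and K: "K * (norm (W + \<gamma> *\<^sub>R P))\<^sup>2 \<le> 4 * \<gamma> * (P \<bullet> W)"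
  shows "(norm (Z - (2 * \<gamma> * l) *\<^sub>R (P + Q)))\<^sup>2 \<le> (1 - l * K) * (norm Z)\<^sup>2"
proof -
  have "l * (K * (norm Z)\<^sup>2) \<le> l * (4 * \<gamma> * (P \<bullet> W))"
    using l K unfolding Z by (intro mult_left_mono) auto
  moreover have "0 \<le> 4 * l * ((1 - l) * (norm (\<gamma> *\<^sub>R (P + Q)))\<^sup>2)" "0 \<le> l * (4 * \<gamma> * (Q \<bullet> V))"
    using l QV \<gamma> by simp_all
  ultimately show ?thesis
    unfolding relaxed_prs_step_norm[OF V Z] by (simp only: ring_distribs)
qed

text \<open>The pairings control \<open>E\<close> and \<open>F\<close>, and the remaining summand
  \<open>\<gamma> *\<^sub>R (P + Q)\<close> is controlled by the residual term with weight
  \<open>1 - l\<close>, which therefore enters the minimum.\<close>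

lemma relaxed_prs_step_contraction_split:
  fixes W P Q :: "'g::real_inner"
  assumes V: "V = W - \<gamma> *\<^sub>R P - \<gamma> *\<^sub>R Q" and Z: "Z = W + \<gamma> *\<^sub>R P"
    and l: "0 < l" "l \<le> 1" and \<gamma>: "\<gamma> > 0" and split: "Z = E + F + \<gamma> *\<^sub>R (P + Q)"
    and ab: "0 \<le> a" "0 \<le> b" "a * (norm E)\<^sup>2 + b * (norm F)\<^sup>2 \<le> \<gamma> * (P \<bullet> W + Q \<bullet> V)"
  shows "(norm (Z - (2 * \<gamma> * l) *\<^sub>R (P + Q)))\<^sup>2 \<le> (1 - 4 * l / 3 * Min {a, b, 1 - l}) * (norm Z)\<^sup>2"
proof -
  let ?m = "Min {a, b, 1 - l}"
  have "?m / 3 * (norm Z)\<^sup>2 \<le> a * (norm E)\<^sup>2 + b * (norm F)\<^sup>2 + (1 - l) * (norm (\<gamma> *\<^sub>R (P + Q)))\<^sup>2"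
    unfolding split using ab l by (intro norm_add3_weighted) auto
  with ab have "?m / 3 * (norm Z)\<^sup>2 \<le> \<gamma> * (P \<bullet> W + Q \<bullet> V) + (1 - l) * (norm (\<gamma> *\<^sub>R (P + Q)))\<^sup>2"
    by linarith
  then have "4 * l * (?m / 3 * (norm Z)\<^sup>2)
      \<le> 4 * l * (\<gamma> * (P \<bullet> W + Q \<bullet> V) + (1 - l) * (norm (\<gamma> *\<^sub>R (P + Q)))\<^sup>2)"
    using l by (intro mult_left_mono) auto
  then show ?thesis
    unfolding relaxed_prs_step_norm[OF V Z] left_diff_distrib by simp
qed

text \<open>As \<open>l k\<close> and \<open>1 - l k\<close> both lie in the unit interval, a lower
  bound on their product bounds each of them.\<close>

lemma eventually_min3_bound:
  fixes a b :: real
  assumes "a > 0" "b > 0" and l: "\<And>k. 0 < l k \<and> l k \<le> 1"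
    and "eventually_bounded_away_from_0 (\<lambda>k. l k * (1 - l k))"
  shows "\<exists>c>0. \<forall>\<^sub>F k in sequentially. c \<le> 4 * l k / 3 * Min {a, b, 1 - l k}"
proof -
  obtain \<epsilon> where \<epsilon>: "\<epsilon> > 0" and ev: "\<forall>\<^sub>F k in sequentially. \<epsilon> \<le> l k * (1 - l k)"
    using assms(4) unfolding eventually_bounded_away_from_0_def by blast
  let ?m = "min a (min b \<epsilon>)"
  have "\<forall>\<^sub>F k in sequentially. 4 * \<epsilon> / 3 * ?m \<le> 4 * l k / 3 * Min {a, b, 1 - l k}"
    using ev
  proof eventually_elim
    case (elim k)
    have "l k * (1 - l k) \<le> l k" "l k * (1 - l k) \<le> 1 - l k"
      using l[of k] by (simp_all add: mult_left_le mult_left_le_one_le)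
    with elim have "\<epsilon> \<le> l k" "\<epsilon> \<le> 1 - l k" by linarith+
    then show ?case
      using assms(1,2) \<epsilon> by (intro mult_mono) auto
  qed
  moreover have "4 * \<epsilon> / 3 * ?m > 0" using assms(1,2) \<epsilon> by simp
  ultimately show ?thesis by blast
qed

section \<open>The four rates for relaxed ADMM\<close>

text \<open>Q-linear convergence asks for contraction factors uniformly below 1. It is therefore
  stated for \<open>lam\<close> eventually bounded away from 0 and, in the last two cases, where
  \<open>1 - lam\<close> enters the proved constant, also from 1. The second case rests on a
  constant free of \<open>1 - lam\<close>.\<close>

theorem theorem11:
  fixes f :: "'a::{real_inner,complete_space} \<Rightarrow> ereal"
    and g :: "'b::{real_inner,complete_space} \<Rightarrow> ereal"
    and A :: "'a \<Rightarrow>\<^sub>L 'g::{real_inner,complete_space}"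
    and B :: "'b \<Rightarrow>\<^sub>L 'g"
    and b zstar :: 'g
    and \<gamma> \<mu>f \<mu>g \<beta>f \<beta>g \<alpha>A \<alpha>B :: real
    and lam :: "int \<Rightarrow> real"
    and x :: "int \<Rightarrow> 'a" and y :: "int \<Rightarrow> 'b" and w :: "int \<Rightarrow> 'g"
    and z :: "nat \<Rightarrow> 'g"
  assumes "A \<noteq> 0" and "B \<noteq> 0"
    and "closed_proper_convex f" and "closed_proper_convex g"
    and dual_solution: "\<exists>v. 0 \<in> {p + q | p q. p \<in> subdifferential (dual_f f A) v \<and>
                                           q \<in> subdifferential (dual_g g B b) v}"
    and chain_f: "\<And>v. subdifferential (dual_f f A) v =
                      A ` subdifferential (fenchel_conjugate f) (adjoint A v)"
    and chain_g: "\<And>v. subdifferential (dual_g g B b) v =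
                      (\<lambda>u. B u - b) ` subdifferential (fenchel_conjugate g) (adjoint B v)"
    and "\<mu>f \<ge> 0" and "\<mu>g \<ge> 0" and "\<beta>f \<ge> 0" and "\<beta>g \<ge> 0" and "\<alpha>A \<ge> 0" and "\<alpha>B \<ge> 0"
    and "strongly_convex \<mu>f f" and "strongly_convex \<mu>g g"
    and "\<beta>f > 0 \<Longrightarrow> lipschitz_gradient (1 / \<beta>f) f"
    and "\<beta>g > 0 \<Longrightarrow> lipschitz_gradient (1 / \<beta>g) g"
    and "\<And>v. A (adjoint A v) \<bullet> v \<ge> \<alpha>A * (norm v)\<^sup>2"
    and "\<And>v. B (adjoint B v) \<bullet> v \<ge> \<alpha>B * (norm v)\<^sup>2"
    and "\<gamma> > 0" and relaxation: "\<And>k. k \<ge> 0 \<Longrightarrow> 0 < lam k \<and> lam k \<le> 1"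
    and "relaxed_admm f g A B b \<gamma> lam x y w"
    and "admm_z_sequence A B b \<gamma> lam x y w z"
    and fixed_point: "T_PRS \<gamma> (dual_f f A) (dual_g g B b) zstar = zstar"
  shows
    "(\<mu>g * \<beta>g * \<alpha>B > 0 \<longrightarrow>
        (\<forall>k. (norm (z (Suc k) - zstar))\<^sup>2
           \<le> sqrt (1 - 4 * \<gamma> * lam (int k) * \<beta>g * \<alpha>B / (1 + \<gamma> * (norm B)\<^sup>2 / \<mu>g)\<^sup>2)
              * (norm (z k - zstar))\<^sup>2) \<and>
        (eventually_bounded_away_from_0 (\<lambda>k. lam (int k)) \<longrightarrow> converges_linearly_to z zstar))
     \<and>
     (\<mu>f * \<beta>f * \<alpha>A > 0 \<longrightarrow>
        (\<forall>k. (norm (z (Suc k) - zstar))\<^sup>2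
           \<le> sqrt (1 - lam (int k) / 2 *
                min (4 * \<gamma> * \<beta>f * \<alpha>A / (1 + \<gamma> * (norm A)\<^sup>2 / \<mu>f)\<^sup>2) (1 - lam (int k)))
              * (norm (z k - zstar))\<^sup>2) \<and>
        (eventually_bounded_away_from_0 (\<lambda>k. lam (int k)) \<longrightarrow> converges_linearly_to z zstar))
     \<and>
     (\<mu>f * \<beta>g * \<alpha>B > 0 \<longrightarrow>
        (\<forall>k. (norm (z (Suc k) - zstar))\<^sup>2
           \<le> sqrt (1 - 4 * lam (int k) / 3 *
                Min {\<gamma> * \<beta>g * \<alpha>B, \<mu>f / ((norm A)\<^sup>2 * \<gamma>), 1 - lam (int k)})
              * (norm (z k - zstar))\<^sup>2) \<and>
        (eventually_bounded_away_from_0 (\<lambda>k. lam (int k) * (1 - lam (int k))) \<longrightarrow>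
           converges_linearly_to z zstar))
     \<and>
     (\<mu>g * \<beta>f * \<alpha>A > 0 \<longrightarrow>
        (\<forall>k. (norm (z (Suc k) - zstar))\<^sup>2
           \<le> sqrt (1 - 4 * lam (int k) / 3 *
                Min {\<gamma> * \<beta>f * \<alpha>A, \<mu>g / ((norm B)\<^sup>2 * \<gamma>), 1 - lam (int k)})
              * (norm (z k - zstar))\<^sup>2) \<and>
        (eventually_bounded_away_from_0 (\<lambda>k. lam (int k) * (1 - lam (int k))) \<longrightarrow>
           converges_linearly_to z zstar))"
proof -
  obtain ws xs ys where ws: "adjoint A ws \<in> subdifferential f xs" "adjoint B ws \<in> subdifferential g ys"
    and sol: "A xs + B ys = b" and zs: "zstar = ws + \<gamma> *\<^sub>R (B ys - b)"
    using T_PRS_fixed_point_kkt[OF assms(3-7) \<open>\<gamma> > 0\<close> fixed_point] by blast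
  define S where "S k = A (x (int k)) + B (y (int k)) - b" for k
  define W where "W k = w (int k) - ws" for k
  define P where "P k = B (y (int k)) - B ys" for k
  define Q where "Q k = A (x (int k)) - A xs" for k
  define V where "V k = (w (int k) - \<gamma> *\<^sub>R S k) - ws" for k
  define Z where "Z k = z k - zstar" for k
  define l where "l k = lam (int k)" for k
  have l: "0 < l k" "l k \<le> 1" for k
    using relaxation by (auto simp: l_def)
  note opt = relaxed_admm_optimality[OF assms(3,4) \<open>relaxed_admm f g A B b \<gamma> lam x y w\<close>, folded S_def]
  have PQ: "P k + Q k = S k" for k
    by (simp add: P_def Q_def S_def flip: sol)
  have V: "V k = W k - \<gamma> *\<^sub>R P k - \<gamma> *\<^sub>R Q k" for k
    by (simp add: V_def W_def algebra_simps flip: PQ)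
  have Z: "Z k = W k + \<gamma> *\<^sub>R P k" for k
    unfolding Z_def W_def P_def zs
      admm_z_eq[OF \<open>relaxed_admm f g A B b \<gamma> lam x y w\<close> \<open>admm_z_sequence A B b \<gamma> lam x y w z\<close>]
    by (simp add: algebra_simps)
  have Z_Suc: "Z (Suc k) = Z k - (2 * \<gamma> * l k) *\<^sub>R (P k + Q k)" for k
    using \<open>admm_z_sequence A B b \<gamma> lam x y w z\<close>
    by (simp add: Z_def PQ S_def l_def admm_z_sequence_def)
  have PW: "0 \<le> P k \<bullet> W k" and QV: "0 \<le> Q k \<bullet> V k" for k
    using adjoint_pair_monotone[OF opt(2) ws(2), of k] adjoint_pair_monotone[OF opt(1) ws(1), of k]
    by (simp_all add: P_def W_def Q_def V_def)
  have strong_P: "\<mu>g * (norm (P k))\<^sup>2 \<le> (norm B)\<^sup>2 * (P k \<bullet> W k)" for k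
    unfolding P_def W_def
    by (rule adjoint_pair_strongly_convex[OF \<open>\<mu>g \<ge> 0\<close> \<open>strongly_convex \<mu>g g\<close> opt(2) ws(2)])
  have strong_Q: "\<mu>f * (norm (Q k))\<^sup>2 \<le> (norm A)\<^sup>2 * (Q k \<bullet> V k)" for k
    unfolding Q_def V_def
    by (rule adjoint_pair_strongly_convex[OF \<open>\<mu>f \<ge> 0\<close> \<open>strongly_convex \<mu>f f\<close> opt(1) ws(1)])
  have lip_W: "\<beta>g * \<alpha>B * (norm (W k))\<^sup>2 \<le> P k \<bullet> W k" if "\<beta>g > 0" for k
    unfolding P_def W_def
    by (rule adjoint_pair_lipschitz_gradient[OF that assms(17)[OF that] assms(19) opt(2) ws(2)])
  have lip_V: "\<beta>f * \<alpha>A * (norm (V k))\<^sup>2 \<le> Q k \<bullet> V k" if "\<beta>f > 0" for k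
    unfolding Q_def V_def
    by (rule adjoint_pair_lipschitz_gradient[OF that assms(16)[OF that] assms(18) opt(1) ws(1)])
  have NA: "(norm A)\<^sup>2 > 0" and NB: "(norm B)\<^sup>2 > 0"
    using \<open>A \<noteq> 0\<close> \<open>B \<noteq> 0\<close> by simp_all
  note \<gamma> = \<open>\<gamma> > 0\<close> and nonneg = \<open>\<mu>f \<ge> 0\<close> \<open>\<mu>g \<ge> 0\<close> \<open>\<beta>f \<ge> 0\<close> \<open>\<beta>g \<ge> 0\<close> \<open>\<alpha>A \<ge> 0\<close> \<open>\<alpha>B \<ge> 0\<close>
  have dist_lin: "converges_linearly_to z zstar"
    if "c > 0" "\<And>k. (norm (Z (Suc k)))\<^sup>2 \<le> (1 - C k) * (norm (Z k))\<^sup>2" "\<forall>\<^sub>F k in sequentially. c \<le> C k" for c C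
    using converges_linearly_toI[of c z zstar C] that unfolding Z_def by blast
  have lin: "converges_linearly_to z zstar"
    if ev: "eventually_bounded_away_from_0 l" and "K > 0"
      and step: "\<And>k. (norm (Z (Suc k)))\<^sup>2 \<le> (1 - l k * K) * (norm (Z k))\<^sup>2" for K
  proof -
    obtain \<epsilon> where \<epsilon>: "\<epsilon> > 0" "\<forall>\<^sub>F k in sequentially. \<epsilon> \<le> l k"
      using ev unfolding eventually_bounded_away_from_0_def by blast
    show ?thesis
    proof (rule dist_lin[OF _ step])
      show "\<epsilon> * K > 0" using \<epsilon> \<open>K > 0\<close> by simp
      show "\<forall>\<^sub>F k in sequentially. \<epsilon> * K \<le> l k * K"
        using \<epsilon>(2) by eventually_elim (use \<open>K > 0\<close> in simp)
    qed
  qed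

  have 1: "(\<forall>k. (norm (Z (Suc k)))\<^sup>2
           \<le> sqrt (1 - 4 * \<gamma> * l k * \<beta>g * \<alpha>B / (1 + \<gamma> * (norm B)\<^sup>2 / \<mu>g)\<^sup>2) * (norm (Z k))\<^sup>2) \<and>
        (eventually_bounded_away_from_0 l \<longrightarrow> converges_linearly_to z zstar)"
    if "\<mu>g * \<beta>g * \<alpha>B > 0"
  proof -
    have pos: "\<mu>g > 0" "\<beta>g > 0" "\<alpha>B > 0"
      using that nonneg by (auto simp: zero_less_mult_iff)
    define K where "K = 4 * \<gamma> * (\<beta>g * \<alpha>B) / (1 + \<gamma> * (norm B)\<^sup>2 / \<mu>g)\<^sup>2"
    have K: "K > 0"
      unfolding K_def using pos \<gamma> by (intro divide_pos_pos zero_less_power add_pos_nonneg) simp_all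
    have step: "(norm (Z (Suc k)))\<^sup>2 \<le> (1 - l k * K) * (norm (Z k))\<^sup>2" for k
      unfolding Z_Suc
    proof (rule relaxed_prs_step_contraction_first[OF V Z l \<gamma> QV])
      show "K * (norm (W k + \<gamma> *\<^sub>R P k))\<^sup>2 \<le> 4 * \<gamma> * (P k \<bullet> W k)"
        unfolding K_def
        by (rule coercive_lipschitz_bound[OF pos(1) \<gamma> _ _ strong_P lip_W[OF pos(2)]]) (use pos in simp_all)
    qed
    have K_eq: "4 * \<gamma> * l k * \<beta>g * \<alpha>B / (1 + \<gamma> * (norm B)\<^sup>2 / \<mu>g)\<^sup>2 = l k * K" for k
      by (simp add: K_def)
    have "(norm (Z (Suc k)))\<^sup>2 \<le> sqrt (1 - l k * K) * (norm (Z k))\<^sup>2" for k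
      by (rule contraction_le_sqrt[OF _ _ _ order_refl step]) (use K l[of k] in simp_all)
    then show ?thesis
      unfolding K_eq using lin[OF _ K step] by blast
  qed
  have 2: "(\<forall>k. (norm (Z (Suc k)))\<^sup>2
           \<le> sqrt (1 - l k / 2 * min (4 * \<gamma> * \<beta>f * \<alpha>A / (1 + \<gamma> * (norm A)\<^sup>2 / \<mu>f)\<^sup>2) (1 - l k))
              * (norm (Z k))\<^sup>2) \<and>
        (eventually_bounded_away_from_0 l \<longrightarrow> converges_linearly_to z zstar)"
    if "\<mu>f * \<beta>f * \<alpha>A > 0"
  proof -
    have pos: "\<mu>f > 0" "\<beta>f > 0" "\<alpha>A > 0"
      using that nonneg by (auto simp: zero_less_mult_iff)
    define K where "K = 4 * \<gamma> * (\<beta>f * \<alpha>A) / (1 + \<gamma> * (norm A)\<^sup>2 / \<mu>f)\<^sup>2"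
    have K: "K > 0"
      unfolding K_def using pos \<gamma> by (intro divide_pos_pos zero_less_power add_pos_nonneg) simp_all
    have step: "(norm (Z (Suc k)))\<^sup>2 \<le> (1 - l k * min K 1) * (norm (Z k))\<^sup>2" for k
      unfolding Z_Suc
    proof (rule relaxed_prs_step_contraction_second[OF V Z l \<gamma> PW])
      show "K * (norm (V k + \<gamma> *\<^sub>R Q k))\<^sup>2 \<le> 4 * \<gamma> * (Q k \<bullet> V k)"
        unfolding K_def
        by (rule coercive_lipschitz_bound[OF pos(1) \<gamma> _ _ strong_Q lip_V[OF pos(2)]]) (use pos in simp_all)
    qed
    have K_eq: "4 * \<gamma> * \<beta>f * \<alpha>A / (1 + \<gamma> * (norm A)\<^sup>2 / \<mu>f)\<^sup>2 = K"
      by (simp add: K_def)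
    have "(norm (Z (Suc k)))\<^sup>2 \<le> sqrt (1 - l k / 2 * min K (1 - l k)) * (norm (Z k))\<^sup>2" for k
    \<comment> \<open>The proved constant \<open>l k * min K 1\<close> dominates the stated one,
      which has an extra half and the smaller cap \<open>1 - l k\<close>.\<close>
    proof (rule contraction_le_sqrt[OF _ _ _ _ step])
      show "0 \<le> l k / 2 * min K (1 - l k)" using K l[of k] by simp
      have "l k / 2 * min K (1 - l k) \<le> l k * min K (1 - l k)"
        using K l[of k] by (intro mult_right_mono) auto
      also have "\<dots> \<le> l k * min K 1"
        using l[of k] by (intro mult_left_mono) auto
      finally show "l k / 2 * min K (1 - l k) \<le> l k * min K 1" .
    qed simp_all
    moreover have "min K 1 > 0" using K by simp
    ultimately show ?thesis
      unfolding K_eq using lin[OF _ _ step] by blast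
  qed
  \<comment> \<open>Shared by the last two cases, which differ only in the choice of
    \<open>E\<close> and \<open>F\<close>.\<close>
  have split: "(\<forall>k. (norm (Z (Suc k)))\<^sup>2
           \<le> sqrt (1 - 4 * l k / 3 * Min {a, c, 1 - l k}) * (norm (Z k))\<^sup>2) \<and>
        (eventually_bounded_away_from_0 (\<lambda>k. l k * (1 - l k)) \<longrightarrow> converges_linearly_to z zstar)"
    if ac: "a > 0" "c > 0"
      and EF: "\<And>k. Z k = E k + F k + \<gamma> *\<^sub>R (P k + Q k)"
      and le: "\<And>k. a * (norm (E k))\<^sup>2 + c * (norm (F k))\<^sup>2 \<le> \<gamma> * (P k \<bullet> W k + Q k \<bullet> V k)"
    for a c E F
  proof -
    have step: "(norm (Z (Suc k)))\<^sup>2 \<le> (1 - 4 * l k / 3 * Min {a, c, 1 - l k}) * (norm (Z k))\<^sup>2" for k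
      unfolding Z_Suc
      by (rule relaxed_prs_step_contraction_split[OF V Z l \<gamma> EF _ _ le]) (use ac in simp_all)
    have "(norm (Z (Suc k)))\<^sup>2 \<le> sqrt (1 - 4 * l k / 3 * Min {a, c, 1 - l k}) * (norm (Z k))\<^sup>2" for k
      by (rule contraction_le_sqrt[OF _ _ _ order_refl step]) (use ac l[of k] in simp_all)
    moreover have "converges_linearly_to z zstar"
      if "eventually_bounded_away_from_0 (\<lambda>k. l k * (1 - l k))"
      using eventually_min3_bound[OF ac _ that] l dist_lin[OF _ step] by blast
    ultimately show ?thesis by blast
  qed
  have 3: "(\<forall>k. (norm (Z (Suc k)))\<^sup>2
           \<le> sqrt (1 - 4 * l k / 3 * Min {\<gamma> * \<beta>g * \<alpha>B, \<mu>f / ((norm A)\<^sup>2 * \<gamma>), 1 - l k}) * (norm (Z k))\<^sup>2) \<and>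
        (eventually_bounded_away_from_0 (\<lambda>k. l k * (1 - l k)) \<longrightarrow> converges_linearly_to z zstar)"
    if "\<mu>f * \<beta>g * \<alpha>B > 0"
  proof -
    have pos: "\<mu>f > 0" "\<beta>g > 0" "\<alpha>B > 0"
      using that nonneg by (auto simp: zero_less_mult_iff)
    show ?thesis
    \<comment> \<open>Only \<open>W\<close> and \<open>Q\<close> are controlled here, so
      \<open>\<gamma> *\<^sub>R P\<close> is rewritten as the residual term minus
      \<open>\<gamma> *\<^sub>R Q\<close>.\<close>
    proof (rule split[where E = W and F = "\<lambda>k. - (\<gamma> *\<^sub>R Q k)"])
      fix k
      show "Z k = W k + - (\<gamma> *\<^sub>R Q k) + \<gamma> *\<^sub>R (P k + Q k)"
        by (simp add: Z algebra_simps)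
      have "\<gamma> * (\<beta>g * \<alpha>B * (norm (W k))\<^sup>2) \<le> \<gamma> * (P k \<bullet> W k)"
        using lip_W[OF pos(2)] \<gamma> by (intro mult_left_mono) auto
      moreover have "\<mu>f / ((norm A)\<^sup>2 * \<gamma>) * (norm (- (\<gamma> *\<^sub>R Q k)))\<^sup>2 \<le> \<gamma> * (Q k \<bullet> V k)"
        using strong_Q[of k] NA \<gamma> by (simp add: power_mult_distrib field_simps power2_eq_square)
      ultimately show "\<gamma> * \<beta>g * \<alpha>B * (norm (W k))\<^sup>2
          + \<mu>f / ((norm A)\<^sup>2 * \<gamma>) * (norm (- (\<gamma> *\<^sub>R Q k)))\<^sup>2 \<le> \<gamma> * (P k \<bullet> W k + Q k \<bullet> V k)"
        by (simp add: distrib_left mult.assoc)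
    qed (use pos \<gamma> NA in simp_all)
  qed
  have 4: "(\<forall>k. (norm (Z (Suc k)))\<^sup>2
           \<le> sqrt (1 - 4 * l k / 3 * Min {\<gamma> * \<beta>f * \<alpha>A, \<mu>g / ((norm B)\<^sup>2 * \<gamma>), 1 - l k}) * (norm (Z k))\<^sup>2) \<and>
        (eventually_bounded_away_from_0 (\<lambda>k. l k * (1 - l k)) \<longrightarrow> converges_linearly_to z zstar)"
    if "\<mu>g * \<beta>f * \<alpha>A > 0"
  proof -
    have pos: "\<mu>g > 0" "\<beta>f > 0" "\<alpha>A > 0"
      using that nonneg by (auto simp: zero_less_mult_iff)
    show ?thesis
    \<comment> \<open>Now \<open>V\<close> and \<open>P\<close> are the controlled quantities, and
      \<open>W\<close> is \<open>V\<close> plus the residual term.\<close>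
    proof (rule split[where E = V and F = "\<lambda>k. \<gamma> *\<^sub>R P k"])
      fix k
      show "Z k = V k + \<gamma> *\<^sub>R P k + \<gamma> *\<^sub>R (P k + Q k)"
        by (simp add: Z V algebra_simps)
      have "\<gamma> * (\<beta>f * \<alpha>A * (norm (V k))\<^sup>2) \<le> \<gamma> * (Q k \<bullet> V k)"
        using lip_V[OF pos(2)] \<gamma> by (intro mult_left_mono) auto
      moreover have "\<mu>g / ((norm B)\<^sup>2 * \<gamma>) * (norm (\<gamma> *\<^sub>R P k))\<^sup>2 \<le> \<gamma> * (P k \<bullet> W k)"
        using strong_P[of k] NB \<gamma> by (simp add: power_mult_distrib field_simps power2_eq_square)
      ultimately show "\<gamma> * \<beta>f * \<alpha>A * (norm (V k))\<^sup>2
          + \<mu>g / ((norm B)\<^sup>2 * \<gamma>) * (norm (\<gamma> *\<^sub>R P k))\<^sup>2 \<le> \<gamma> * (P k \<bullet> W k + Q k \<bullet> V k)"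
        by (simp add: distrib_left mult.assoc)
    qed (use pos \<gamma> NB in simp_all)
  qed
  show ?thesis
    using 1 2 3 4 unfolding Z_def l_def by blast
qed

end
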